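(* For each $n$ let $\pi_{n,t}$ be the queue length distribution (distribution of the number $q$ of customers) at time $t\ge0$, and $\nu_n$ the stationary distribution, of the continuous-time $M/M/n$ queue with arrival rate $\lambda_n$ and service rate $1$. (a) Let $\lambda_n=n-n^{1-\alpha}$ with $\alpha>0$ fixed and $n\ge2$. (i) If $\alpha\ge1$, then $\left|\mathbb E_{\pi_{n,t}}[q]-\mathbb E_{\nu_n}[q]\right|\le e^{-(\sqrt n-\sqrt{\lambda_n})^2t}\sqrt2\,(n+n^\alpha)\,\chi(\pi_{n,0},\nu_n)$. (ii) If $\alpha\in(1/2,1)$, then $\left|\mathbb E_{\pi_{n,t}}[q]-\mathbb E_{\nu_n}[q]\right|\le e^{-C_n(\sqrt n-\sqrt{\lambda_n})^2t}\sqrt2\,(n+n^\alpha)\,\chi(\pi_{n,0},\nu_n)$ for some $C_n>0$ such that $\lim_{n\to\infty}C_n=1$. (iii) If $\alpha\in(0,1/2)$, then $\left|\mathbb E_{\pi_{n,t}}[q]-\mathbb E_{\nu_n}[q]\right|\le e^{-D_nt}\sqrt2\,(n+n^\alpha)\,\chi(\pi_{n,0},\nu_n)$ for some $D_n>0$ such that $\lim_{n\to\infty}D_n=1/25$. (b) If instead $(\lambda_n)$ is a sequence of arrival rates with $\lambda_n\in(0,n)$ and $\lim_{n\to\infty}\frac{\lambda_n}n=c$ for some $c\in[0,1)$, then $$\left|\mathbb E_{\pi_{n,t}}[q]-\mathbb E_{\nu_n}[q]\right|\le e^{-L_nt}\,n\,\chi(\pi_{n,0},\nu_n)$$ for some $L_n>0$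 such that $\lim_{n\to\infty}L_n=1-c$.
   Context: The $M/M/n$ queue with arrival rate $\lambda$ and service rate $1$ is the continuous-time birth-and-death Markov chain on $\mathbb Z_{\ge0}$ (state = number of customers) with birth rate $\lambda$ in every state and death rate $\min\{n,q\}$ in state $q$. For $0<\lambda<n$ it has a unique stationary distribution. For probability distributions $P,Q$ on a countable set $S$ with $P$ absolutely continuous with respect to $Q$, $\chi^2(P,Q)=\sum_{x\in S}\frac{(P(x)-Q(x))^2}{Q(x)}$ and $\chi(P,Q)=\sqrt{\chi^2(P,Q)}$.
   Formalization: In (b) the bound is claimed for all sufficiently large n (threshold depending only on the sequence of arrival rates), not for each n: it fails for n=1, λ_1=0.9 at t=0, since ν_1 has standard deviation √90>1. *)

theory Defs
  imports "HOL-Probability.Probability"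
begin

text \<open>
  A time-homogeneous continuous-time Markov chain is given by its transition function: \<open>P t x\<close> is
  the law at time \<open>t\<close> of the chain started in \<open>x\<close>. Stochasticity of \<open>P t\<close> is part of the type
  \<^typ>\<open>'a pmf\<close>; only times \<open>t \<ge> 0\<close> are constrained.
\<close>

definition transition_semigroup :: "(real \<Rightarrow> 'a \<Rightarrow> 'a pmf) \<Rightarrow> bool" where
  "transition_semigroup P \<longleftrightarrow>
     (\<forall>x. P 0 x = return_pmf x) \<and>
     (\<forall>s\<ge>0. \<forall>t\<ge>0. \<forall>x. P (s + t) x = bind_pmf (P s x) (P t))"

definition has_rates :: "(real \<Rightarrow> 'a \<Rightarrow> 'a pmf) \<Rightarrow> ('a \<Rightarrow> 'a \<Rightarrow> real) \<Rightarrow> bool" where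
  "has_rates P G \<longleftrightarrow>
     (\<forall>x y. ((\<lambda>t. pmf (P t x) y) has_real_derivative G x y) (at 0 within {0..}))"

definition markov_chain :: "('a \<Rightarrow> 'a \<Rightarrow> real) \<Rightarrow> (real \<Rightarrow> 'a \<Rightarrow> 'a pmf) \<Rightarrow> bool" where
  "markov_chain G P \<longleftrightarrow> transition_semigroup P \<and> has_rates P G"

definition law_at :: "(real \<Rightarrow> 'a \<Rightarrow> 'a pmf) \<Rightarrow> 'a pmf \<Rightarrow> real \<Rightarrow> 'a pmf" where
  "law_at P \<pi>0 t = bind_pmf \<pi>0 (P t)"

definition stationary :: "(real \<Rightarrow> 'a \<Rightarrow> 'a pmf) \<Rightarrow> 'a pmf \<Rightarrow> bool" where
  "stationary P \<nu> \<longleftrightarrow> (\<forall>t\<ge>0. law_at P \<nu> t = \<nu>)"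

definition birth_death_rates :: "(nat \<Rightarrow> real) \<Rightarrow> (nat \<Rightarrow> real) \<Rightarrow> nat \<Rightarrow> nat \<Rightarrow> real" where
  "birth_death_rates b d x y =
     (if y = Suc x then b x
      else if x = Suc y then d x
      else if y = x then - (b x + d x)
      else 0)"

definition mmn_rates :: "nat \<Rightarrow> real \<Rightarrow> nat \<Rightarrow> nat \<Rightarrow> real" where
  "mmn_rates n lam = birth_death_rates (\<lambda>q. lam) (\<lambda>q. real (min n q))"

text \<open>
  The chi-square divergence requires absolute continuity and may be infinite; \<open>chi_sq\<close> is meaningful
  only under \<open>chi_sq_finite\<close>.
\<close>

definition chi_sq_finite :: "'a pmf \<Rightarrow> 'a pmf \<Rightarrow> bool" where
  "chi_sq_finite P Q \<longleftrightarrow>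
     set_pmf P \<subseteq> set_pmf Q \<and> (\<lambda>x. (pmf P x - pmf Q x)\<^sup>2 / pmf Q x) summable_on UNIV"

definition chi_sq :: "'a pmf \<Rightarrow> 'a pmf \<Rightarrow> real" where
  "chi_sq P Q = (\<Sum>\<^sub>\<infinity>x. (pmf P x - pmf Q x)\<^sup>2 / pmf Q x)"

definition chi :: "'a pmf \<Rightarrow> 'a pmf \<Rightarrow> real" where
  "chi P Q = sqrt (chi_sq P Q)"

text \<open>
  The mean number of customers in the M/M/n queue with arrival rate \<open>lam\<close> approaches its stationary
  value at exponential rate \<open>r\<close> with prefactor \<open>K\<close>, for every initial law. If the chi-square
  divergence of the initial law is infinite, the right-hand side is infinite and nothing is claimed.
  Integrability is included because \<^const>\<open>measure_pmf.expectation\<close> is 0 for divergent means.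
\<close>

definition mean_queue_bound :: "nat \<Rightarrow> real \<Rightarrow> real \<Rightarrow> real \<Rightarrow> bool" where
  "mean_queue_bound n lam r K \<longleftrightarrow>
     (\<forall>P \<nu> \<pi>0 t.
        markov_chain (mmn_rates n lam) P \<longrightarrow> stationary P \<nu> \<longrightarrow> chi_sq_finite \<pi>0 \<nu> \<longrightarrow> t \<ge> 0 \<longrightarrow>
        integrable (measure_pmf (law_at P \<pi>0 t)) real \<and>
        integrable (measure_pmf \<nu>) real \<and>
        \<bar>measure_pmf.expectation (law_at P \<pi>0 t) real - measure_pmf.expectation \<nu> real\<bar>
          \<le> exp (- r * t) * K * chi \<pi>0 \<nu>)"

end

theory Submission
  imports Defs "HOL-Real_Asymp.Real_Asymp"
begin

text \<open>
  A positive function \<open>g\<close> on the edges \<open>{i, i + 1}\<close> with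
  \<open>lam * g (i + 1) - (lam + min n (i + 1)) * g i + min n i * g (i - 1) \<le> - \<gamma> * g i\<close> is a supersolution
  of the equation satisfied by the increments of \<open>P\<^sub>t f\<close>. By the maximum principle these increments
  stay below \<open>exp (- \<gamma> t) * g\<close>, so \<open>P\<^sub>t f - \<nu> f\<close> decays at rate \<open>\<gamma>\<close> in \<open>L\<^sup>2(\<nu>)\<close> up to a constant
  factor. Reversibility makes the squared norm log-convex in \<open>t\<close>, which removes the factor. The
  Cauchy-Schwarz inequality against the density of \<open>\<pi> - \<nu>\<close> then gives the bound with rate \<open>\<gamma>\<close> and
  prefactor \<open>K\<close> as soon as the second moment of \<open>q - n\<close> under \<open>\<nu>\<close> is at most \<open>K\<^sup>2\<close>.

  The test functions grow geometrically above \<open>n\<close>, with ratio close to \<open>sqrt (n / lam)\<close> if the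
  critical rate is wanted. Below \<open>n\<close> a constant is enough in part (b) and for \<open>\<alpha> \<ge> 1\<close>. For \<open>\<alpha> < 1\<close> the
  slope at \<open>n\<close> is too large for a single kink and is built up by a quadratic ramp on \<open>[lam, n]\<close>.
\<close>

section \<open>Maximum principle and decay\<close>

text \<open>For \<open>i < n\<close> the inequality reads \<open>lam * (g (i + 1) - g i) - i * (g i
  - g (i - 1)) \<le> (1 - \<gamma>) * g i\<close>: one more busy server per customer gives a unit
  gain. From \<open>n\<close> on this gain is lost, and a ratio \<open>r\<close> gives the rate
  \<open>(r - 1) * (n / r - lam)\<close>, whose maximum \<open>(sqrt n - sqrt lam)^2\<close> is
  attained at \<open>sqrt (n / lam)\<close>. The obstacle is the edge \<open>n - 1\<close>, where
  the kink costs \<open>lam * (r - 1)\<close>. Let \<open>\<delta> = n - lam\<close>, which is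
  \<open>n powr (1 - \<alpha>)\<close> in part (a). The critical ratio costs at most
  \<open>\<delta> / 2\<close>, covered by the unit gain when \<open>\<delta> \<le> 1\<close>. For
  larger \<open>\<delta>\<close> the term \<open>- i * (g i - g (i - 1))\<close> has to pay: a ramp
  of length about \<open>\<delta>\<close> and curvature about \<open>1 / n\<close> earns about
  \<open>\<delta>\<close> there. The curvature uses up unit gain inside the ramp, so no rate above 1
  can come out, while the critical rate has order \<open>\<delta>^2 / n\<close>, unbounded for
  \<open>\<alpha> < 1/2\<close>. In that regime the ratio is only
  \<open>1 + 1 / (2 * \<delta>)\<close>; above \<open>n\<close> it would allow \<open>4/11\<close>,
  so \<open>1/25\<close> has ample room and is reached exactly for large \<open>n\<close>.\<close>

text \<open>Left derivatives are not at hand: the rates are derivatives at time 0, and the semigroup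
  law moves them to later times from the right only. Lowering \<open>\<phi>\<close> by a line of
  slope \<open>e\<close> makes all right derivatives negative, so the last time at which the lowered
  function is nonpositive cannot come before \<open>T\<close>.\<close>

lemma right_deriv_nonpos_imp_le:
  fixes \<phi> D :: "real \<Rightarrow> real"
  assumes "0 \<le> T" and cont: "continuous_on {0..T} \<phi>"
    and deriv: "\<And>t. 0 \<le> t \<Longrightarrow> t < T \<Longrightarrow> (\<phi> has_real_derivative D t) (at t within {t..})"
    and nonpos: "\<And>t. 0 \<le> t \<Longrightarrow> t < T \<Longrightarrow> D t \<le> 0"
  shows "\<phi> T \<le> \<phi> 0"
proof (rule ccontr)
  assume "\<not> \<phi> T \<le> \<phi> 0"
  then have less: "\<phi> 0 < \<phi> T" by simp
  then have "0 < T" using \<open>0 \<le> T\<close> by (cases "T = 0") auto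
  \<comment> \<open>Half the mean slope on \<open>[0, T]\<close>: positive, yet small enough to keep
    \<open>\<psi> T\<close> positive.\<close>
  define e where "e = (\<phi> T - \<phi> 0) / (2 * T)"
  have "e > 0" using less \<open>0 < T\<close> by (simp add: e_def)
  define \<psi> where "\<psi> = (\<lambda>t. \<phi> t - \<phi> 0 - e * t)"
  have "\<psi> T > 0" using less \<open>0 < T\<close> by (simp add: \<psi>_def e_def field_simps)
  define S where "S = {t \<in> {0..T}. \<psi> t \<le> 0}"
  have "continuous_on {0..T} \<psi>" unfolding \<psi>_def by (intro continuous_intros cont)
  then have "closed S"
    unfolding S_def by (intro continuous_closed_preimage_constant continuous_on_closed_Collect_le
        closed_Collect_le continuous_on_const) auto
  moreover have "bounded S" by (rule bounded_subset[of "{0..T}"]) (auto simp: S_def)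
  ultimately have "compact S" by (simp add: compact_eq_bounded_closed)
  moreover have "0 \<in> S" using \<open>0 < T\<close> by (simp add: S_def \<psi>_def)
  ultimately obtain u where u: "u \<in> S" "\<And>t. t \<in> S \<Longrightarrow> t \<le> u"
    using compact_attains_sup[of S] by blast
  have "u < T" "0 \<le> u" "\<psi> u \<le> 0"
    using u(1) \<open>\<psi> T > 0\<close> by (auto simp: S_def less_le)
  have "(\<psi> has_real_derivative D u - e) (at u within {u..})"
    unfolding \<psi>_def using deriv[OF \<open>0 \<le> u\<close> \<open>u < T\<close>] by (auto intro!: derivative_eq_intros)
  moreover have "D u - e < 0" using nonpos[OF \<open>0 \<le> u\<close> \<open>u < T\<close>] \<open>e > 0\<close> by simp
  ultimately obtain d where d: "d > 0" "\<And>h. h > 0 \<Longrightarrow> u + h \<in> {u..} \<Longrightarrow> h < d \<Longrightarrow> \<psi> (u + h) < \<psi> u"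
    using has_real_derivative_neg_dec_right by blast
  define h where "h = min (d / 2) (T - u)"
  have h: "h > 0" "h < d" "u + h \<le> T" using d(1) \<open>u < T\<close> by (auto simp: h_def min_def)
  with d(2)[of h] \<open>\<psi> u \<le> 0\<close> \<open>0 \<le> u\<close> have "u + h \<in> S" by (simp add: S_def)
  with u(2) h(1) show False by fastforce
qed

text \<open>Multiplication by \<open>exp (\<Lambda> * t)\<close> removes the diagonal and leaves
  \<open>A + \<Lambda>\<close>, which is controlled on functions dominated by a multiple of
  \<open>g\<close>. Integrating the a priori bound \<open>m\<close> through the equation improves
  it: of the excess \<open>m - m0\<close> only the fraction
  \<open>1 - exp (- (\<Lambda> - \<gamma>) * t)\<close> survives. No supremum over \<open>i\<close>
  has to be attained, so infinitely many coordinates are allowed.\<close>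

lemma maximum_principle_step:
  fixes w :: "real \<Rightarrow> 'i \<Rightarrow> real" and A :: "('i \<Rightarrow> real) \<Rightarrow> 'i \<Rightarrow> real"
  assumes cont: "\<And>i. continuous_on {0..} (\<lambda>t. w t i)"
    and deriv: "\<And>t i. 0 \<le> t \<Longrightarrow> ((\<lambda>s. w s i) has_real_derivative A (w t) i) (at t within {t..})"
    and A: "\<And>v m i. (\<And>j. \<bar>v j\<bar> \<le> m * g j) \<Longrightarrow> \<bar>A v i + \<Lambda> * v i\<bar> \<le> (\<Lambda> - \<gamma>) * (m * g i)"
    and init: "\<And>i. \<bar>w 0 i\<bar> \<le> m0 * g i"
    and bound: "\<And>t i. 0 \<le> t \<Longrightarrow> t \<le> T \<Longrightarrow> \<bar>w t i\<bar> \<le> m * exp (- \<gamma> * t) * g i"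
    and t: "0 \<le> t" "t \<le> T"
  shows "\<bar>w t i\<bar> \<le> (m - exp (- (\<Lambda> - \<gamma>) * t) * (m - m0)) * exp (- \<gamma> * t) * g i"
proof -
  have main: "\<sigma> * w t i \<le> (m - exp (- (\<Lambda> - \<gamma>) * t) * (m - m0)) * exp (- \<gamma> * t) * g i"
    if "\<sigma> = 1 \<or> \<sigma> = -1" for \<sigma> :: real
  proof -
    \<comment> \<open>The subtracted term is a primitive of the bound on the driving term, so
      \<open>\<psi>\<close> cannot increase.\<close>
    define \<psi> where "\<psi> s = exp (\<Lambda> * s) * (\<sigma> * w s i) - m * g i * exp ((\<Lambda> - \<gamma>) * s)" for s
    define D where "D s = exp (\<Lambda> * s) * \<sigma> * (A (w s) i + \<Lambda> * w s i)
       - m * g i * ((\<Lambda> - \<gamma>) * exp ((\<Lambda> - \<gamma>) * s))" for s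
    have "\<psi> t \<le> \<psi> 0"
    proof (rule right_deriv_nonpos_imp_le[where D = D])
      show "continuous_on {0..t} \<psi>" unfolding \<psi>_def
        by (intro continuous_intros continuous_on_subset[OF cont]) auto
      fix s assume s: "0 \<le> s" "s < t"
      show "(\<psi> has_real_derivative D s) (at s within {s..})"
        unfolding \<psi>_def D_def using s
        by (auto intro!: derivative_eq_intros deriv simp: algebra_simps)
      have "\<sigma> * (A (w s) i + \<Lambda> * w s i) \<le> \<bar>A (w s) i + \<Lambda> * w s i\<bar>"
        using that by auto
      also have "\<dots> \<le> (\<Lambda> - \<gamma>) * (m * exp (- \<gamma> * s) * g i)"
        using bound[of s] s t by (intro A) auto
      finally have "exp (\<Lambda> * s) * (\<sigma> * (A (w s) i + \<Lambda> * w s i))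
          \<le> exp (\<Lambda> * s) * ((\<Lambda> - \<gamma>) * (m * exp (- \<gamma> * s) * g i))"
        by (intro mult_left_mono) auto
      also have "exp (\<Lambda> * s) * exp (- \<gamma> * s) = exp ((\<Lambda> - \<gamma>) * s)"
        by (simp add: exp_add[symmetric] algebra_simps)
      then have "exp (\<Lambda> * s) * ((\<Lambda> - \<gamma>) * (m * exp (- \<gamma> * s) * g i))
          = m * g i * ((\<Lambda> - \<gamma>) * exp ((\<Lambda> - \<gamma>) * s))"
        by (metis (no_types, opaque_lifting) mult.assoc mult.commute)
      finally show "D s \<le> 0" by (simp add: D_def mult.assoc)
    qed (use t in auto)
    moreover have "\<psi> 0 \<le> (m0 - m) * g i"
      using init[of i] that by (auto simp: \<psi>_def algebra_simps)
    ultimately have "exp (\<Lambda> * t) * (\<sigma> * w t i) \<le> g i * (m * exp ((\<Lambda> - \<gamma>) * t) - (m - m0))"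
      by (simp add: \<psi>_def algebra_simps)
    then have "exp (- \<Lambda> * t) * (exp (\<Lambda> * t) * (\<sigma> * w t i))
        \<le> exp (- \<Lambda> * t) * (g i * (m * exp ((\<Lambda> - \<gamma>) * t) - (m - m0)))"
      by (intro mult_left_mono) auto
    also have "exp (- \<Lambda> * t) * (exp (\<Lambda> * t) * (\<sigma> * w t i)) = \<sigma> * w t i"
      by (simp add: mult.assoc[symmetric] exp_add[symmetric])
    also have "exp (- \<Lambda> * t) * (g i * (m * exp ((\<Lambda> - \<gamma>) * t) - (m - m0)))
        = (m * (exp (- \<Lambda> * t) * exp ((\<Lambda> - \<gamma>) * t)) - exp (- \<Lambda> * t) * (m - m0)) * g i"
      by (simp only: algebra_simps)
    also have "exp (- \<Lambda> * t) * exp ((\<Lambda> - \<gamma>) * t) = exp (- \<gamma> * t)"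
      by (simp add: exp_add[symmetric] algebra_simps)
    also have "exp (- \<Lambda> * t) = exp (- (\<Lambda> - \<gamma>) * t) * exp (- \<gamma> * t)"
      by (simp add: exp_add[symmetric] algebra_simps)
    finally show ?thesis by (simp only: algebra_simps)
  qed
  from main[of 1] main[of "-1"] show ?thesis by auto
qed

text \<open>The crude bound \<open>B\<close> supplies a first a priori constant; each further
  application of the step on \<open>[0, T]\<close> multiplies the excess over \<open>m0\<close> by
  \<open>q < 1\<close>, and in the limit only \<open>m0\<close> remains.\<close>

lemma maximum_principle:
  fixes w :: "real \<Rightarrow> 'i \<Rightarrow> real" and A :: "('i \<Rightarrow> real) \<Rightarrow> 'i \<Rightarrow> real"
  assumes cont: "\<And>i. continuous_on {0..} (\<lambda>t. w t i)"
    and deriv: "\<And>t i. 0 \<le> t \<Longrightarrow> ((\<lambda>s. w s i) has_real_derivative A (w t) i) (at t within {t..})"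
    and A: "\<And>v m i. (\<And>j. \<bar>v j\<bar> \<le> m * g j) \<Longrightarrow> \<bar>A v i + \<Lambda> * v i\<bar> \<le> (\<Lambda> - \<gamma>) * (m * g i)"
    and init: "\<And>i. \<bar>w 0 i\<bar> \<le> m0 * g i"
    and bound: "\<And>t i. 0 \<le> t \<Longrightarrow> \<bar>w t i\<bar> \<le> B * g i"
    and "\<gamma> < \<Lambda>" "0 \<le> \<gamma>" and g: "\<And>i. 0 < g i" and "0 \<le> T"
  shows "\<bar>w T i\<bar> \<le> m0 * exp (- \<gamma> * T) * g i"
proof -
  define q where "q = 1 - exp (- (\<Lambda> - \<gamma>) * T)"
  have "0 \<le> (\<Lambda> - \<gamma>) * T" using \<open>\<gamma> < \<Lambda>\<close> \<open>0 \<le> T\<close> by simp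
  then have q: "0 \<le> q" "q < 1" by (auto simp: q_def algebra_simps)
  \<comment> \<open>The factor \<open>exp (\<gamma> * T)\<close> lets the constant bound
    \<open>B\<close> pass for a multiple of \<open>exp (- \<gamma> * t)\<close> on
    \<open>[0, T]\<close>; the maximum keeps the excess over \<open>m0\<close> nonnegative.\<close>
  define M where "M = max m0 (B * exp (\<gamma> * T))"
  have iter: "\<forall>t i. 0 \<le> t \<longrightarrow> t \<le> T \<longrightarrow> \<bar>w t i\<bar> \<le> (m0 + q ^ k * (M - m0)) * exp (- \<gamma> * t) * g i" for k
  proof (induction k)
    case 0
    show ?case
    proof (intro allI impI)
      fix t i assume t: "0 \<le> t" "t \<le> T"
      have "0 \<le> B" using bound[of 0 i] g[of i]
        by (metis abs_ge_zero landau_o.R_refl le_less_trans mult_neg_pos not_le)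
      have "B = B * exp (\<gamma> * t) * exp (- \<gamma> * t)"
        by (simp add: mult.assoc exp_add[symmetric])
      also have "\<dots> \<le> B * exp (\<gamma> * T) * exp (- \<gamma> * t)"
        using t \<open>0 \<le> \<gamma>\<close> \<open>0 \<le> B\<close> by (intro mult_right_mono mult_left_mono) (auto intro: mult_left_mono)
      also have "\<dots> \<le> M * exp (- \<gamma> * t)" by (intro mult_right_mono) (auto simp: M_def)
      finally have "B * g i \<le> M * exp (- \<gamma> * t) * g i"
        using g[of i] by (intro mult_right_mono) auto
      with bound[of t i] t show "\<bar>w t i\<bar> \<le> (m0 + q ^ 0 * (M - m0)) * exp (- \<gamma> * t) * g i"
        by simp
    qed
  next
    case (Suc k)
    define m where "m = m0 + q ^ k * (M - m0)"
    have "m0 \<le> m" using q by (simp add: m_def M_def)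
    show ?case
    proof (intro allI impI)
      fix t i assume t: "0 \<le> t" "t \<le> T"
      have "\<bar>w t i\<bar> \<le> (m - exp (- (\<Lambda> - \<gamma>) * t) * (m - m0)) * exp (- \<gamma> * t) * g i"
        by (rule maximum_principle_step[OF cont deriv A init, where T = T])
          (use Suc t in \<open>auto simp: m_def\<close>)
      also have "\<dots> \<le> (m - exp (- (\<Lambda> - \<gamma>) * T) * (m - m0)) * exp (- \<gamma> * t) * g i"
        using t \<open>m0 \<le> m\<close> \<open>\<gamma> < \<Lambda>\<close> g[of i]
        by (intro mult_right_mono diff_left_mono) (auto intro: mult_left_mono)
      also have "m - exp (- (\<Lambda> - \<gamma>) * T) * (m - m0) = m0 + q ^ Suc k * (M - m0)"
        by (simp add: m_def q_def algebra_simps)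
      finally show "\<bar>w t i\<bar> \<le> (m0 + q ^ Suc k * (M - m0)) * exp (- \<gamma> * t) * g i" .
    qed
  qed
  have "(\<lambda>k. (m0 + q ^ k * (M - m0)) * exp (- \<gamma> * T) * g i) \<longlonglongrightarrow> (m0 + 0 * (M - m0)) * exp (- \<gamma> * T) * g i"
    using q by (intro tendsto_intros) auto
  then show ?thesis
    using iter \<open>0 \<le> T\<close> by (intro LIMSEQ_le_const[where a = "\<bar>w T i\<bar>"]) (auto simp: mult.assoc)
qed

section \<open>Cauchy-Schwarz and decay from doubling\<close>

lemma cauchy_schwarz_integral:
  fixes f g :: "'a \<Rightarrow> real"
  assumes f: "integrable M (\<lambda>x. (f x)\<^sup>2)" and g: "integrable M (\<lambda>x. (g x)\<^sup>2)"
    and fg: "integrable M (\<lambda>x. f x * g x)"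
  shows "(\<integral>x. f x * g x \<partial>M)\<^sup>2 \<le> (\<integral>x. (f x)\<^sup>2 \<partial>M) * (\<integral>x. (g x)\<^sup>2 \<partial>M)"
proof -
  define F G X where "F = (\<integral>x. (f x)\<^sup>2 \<partial>M)" and "G = (\<integral>x. (g x)\<^sup>2 \<partial>M)"
    and "X = (\<integral>x. f x * g x \<partial>M)"
  have quad: "0 \<le> F - 2 * s * X + s\<^sup>2 * G" for s
  proof -
    have "0 \<le> (\<integral>x. (f x - s * g x)\<^sup>2 \<partial>M)" by simp
    also have "(\<lambda>x. (f x - s * g x)\<^sup>2) = (\<lambda>x. (f x)\<^sup>2 - 2 * s * (f x * g x) + s\<^sup>2 * (g x)\<^sup>2)"
      by (simp add: fun_eq_iff power2_eq_square algebra_simps)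
    also have "(\<integral>x. (f x)\<^sup>2 - 2 * s * (f x * g x) + s\<^sup>2 * (g x)\<^sup>2 \<partial>M) = F - 2 * s * X + s\<^sup>2 * G"
      using f g fg by (simp add: F_def G_def X_def)
    finally show ?thesis .
  qed
  have "X\<^sup>2 \<le> F * G"
  proof (cases "G = 0")
    case True
    have "X = 0"
    proof (rule ccontr)
      assume "X \<noteq> 0"
      \<comment> \<open>With \<open>G = 0\<close> the quadratic is linear in \<open>s\<close>, and
        this \<open>s\<close> gives it the value -1.\<close>
      with quad[of "(F + 1) / (2 * X)"] True show False by simp
    qed
    with True show ?thesis by simp
  next
    case False
    then have "G > 0" by (simp add: G_def less_le)
    have "0 \<le> (F - 2 * (X / G) * X + (X / G)\<^sup>2 * G) * G"
      using quad[of "X / G"] \<open>G > 0\<close> by (intro mult_nonneg_nonneg) auto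
    also have "\<dots> = F * G - X\<^sup>2"
      using \<open>G > 0\<close> by (simp add: field_simps power2_eq_square)
    finally show ?thesis by simp
  qed
  then show ?thesis by (simp add: F_def G_def X_def)
qed

text \<open>A function with \<open>\<phi>(t)\<^sup>2 \<le> \<phi>(0) \<phi>(2t)\<close>, as log-convexity implies, cannot start to decay
  more slowly than it does in the long run: the constant \<open>C\<close> is washed out by repeated doubling.\<close>

lemma decay_constant_from_doubling:
  fixes \<phi> :: "real \<Rightarrow> real"
  assumes nonneg: "\<And>t. 0 \<le> t \<Longrightarrow> 0 \<le> \<phi> t"
    and doubling: "\<And>t. 0 \<le> t \<Longrightarrow> (\<phi> t)\<^sup>2 \<le> \<phi> 0 * \<phi> (2 * t)"
    and bound: "\<And>t. 0 \<le> t \<Longrightarrow> \<phi> t \<le> C * exp (- a * t)"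
    and "0 \<le> T"
  shows "\<phi> T \<le> \<phi> 0 * exp (- a * T)"
proof (cases "\<phi> 0 = 0")
  case True
  with doubling[OF \<open>0 \<le> T\<close>] show ?thesis by simp
next
  case False
  with nonneg[of 0] have pos: "\<phi> 0 > 0" by simp
  \<comment> \<open>The claim is \<open>z \<le> 1\<close>; the a priori decay will bound the powers
    \<open>z ^ (2 ^ k)\<close> independently of \<open>k\<close>.\<close>
  define z where "z = \<phi> T / \<phi> 0 * exp (a * T)"
  have "0 \<le> z" using nonneg[OF \<open>0 \<le> T\<close>] pos by (simp add: z_def)
  have z: "z ^ (2 ^ k) \<le> \<phi> (2 ^ k * T) / \<phi> 0 * exp (a * (2 ^ k * T))" for k :: nat
  proof (induction k)
    case (Suc k)
    have "z ^ (2 ^ Suc k) = (z ^ (2 ^ k))\<^sup>2" by (simp add: power_mult[symmetric] mult.commute)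
    also have "\<dots> \<le> (\<phi> (2 ^ k * T) / \<phi> 0 * exp (a * (2 ^ k * T)))\<^sup>2"
      using Suc \<open>0 \<le> z\<close> by (intro power_mono) auto
    also have "\<dots> = (\<phi> (2 ^ k * T))\<^sup>2 / (\<phi> 0)\<^sup>2 * exp (a * (2 ^ Suc k * T))"
      by (simp add: power_mult_distrib power_divide exp_double[symmetric] mult.assoc mult.left_commute)
    also have "\<dots> \<le> (\<phi> 0 * \<phi> (2 * (2 ^ k * T))) / (\<phi> 0)\<^sup>2 * exp (a * (2 ^ Suc k * T))"
      using doubling[of "2 ^ k * T"] \<open>0 \<le> T\<close> by (intro mult_right_mono divide_right_mono) auto
    also have "\<dots> = \<phi> (2 ^ Suc k * T) / \<phi> 0 * exp (a * (2 ^ Suc k * T))"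
      using pos by (simp add: power2_eq_square mult.assoc)
    finally show ?case .
  qed (simp add: z_def)
  have "z \<le> 1"
  proof (rule ccontr)
    assume "\<not> z \<le> 1"
    then obtain N where N: "C / \<phi> 0 < z ^ N" using real_arch_pow[of z "C / \<phi> 0"] by auto
    have "N \<le> 2 ^ N" using less_exp[of N] by simp
    with \<open>\<not> z \<le> 1\<close> have "z ^ N \<le> z ^ (2 ^ N)" by (intro power_increasing) auto
    also note z[of N]
    also have "\<phi> (2 ^ N * T) / \<phi> 0 * exp (a * (2 ^ N * T))
        \<le> C * exp (- a * (2 ^ N * T)) / \<phi> 0 * exp (a * (2 ^ N * T))"
      using bound[of "2 ^ N * T"] \<open>0 \<le> T\<close> pos by (intro mult_right_mono divide_right_mono) auto
    also have "\<dots> = C / \<phi> 0" by (simp add: exp_minus field_simps)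
    finally show False using N by simp
  qed
  then have "z * (\<phi> 0 * exp (- a * T)) \<le> 1 * (\<phi> 0 * exp (- a * T))"
    using pos by (intro mult_right_mono) auto
  then show ?thesis using pos by (simp add: z_def exp_minus field_simps)
qed

section \<open>Birth-death chains\<close>

lemma integrable_bounded_pmf:
  fixes f :: "'a \<Rightarrow> real"
  assumes "\<And>x. \<bar>f x\<bar> \<le> B"
  shows "integrable (measure_pmf p) f"
  using assms by (intro measure_pmf.integrable_const_bound[where B = B]) auto

lemma abs_expectation_le:
  fixes f :: "'a \<Rightarrow> real"
  assumes "\<And>x. \<bar>f x\<bar> \<le> B"
  shows "\<bar>measure_pmf.expectation p f\<bar> \<le> B"
proof -
  have "\<bar>measure_pmf.expectation p f\<bar> \<le> measure_pmf.expectation p (\<lambda>x. \<bar>f x\<bar>)"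
    by (rule integral_abs_bound)
  also have "\<dots> \<le> measure_pmf.expectation p (\<lambda>x. B)"
    using assms by (intro integral_mono integrable_bounded_pmf[where B = "\<bar>B\<bar>"])
      (auto intro: order_trans[OF _ abs_ge_self])
  finally show ?thesis by simp
qed

lemma expectation_bind_pmf:
  fixes f :: "'b \<Rightarrow> real"
  assumes "\<And>x. \<bar>f x\<bar> \<le> B"
  shows "measure_pmf.expectation (bind_pmf p q) f
    = measure_pmf.expectation p (\<lambda>x. measure_pmf.expectation (q x) f)"
  unfolding measure_pmf_bind
  by (rule integral_bind[where B = B and B' = 1 and K = "count_space UNIV"])
    (use assms in \<open>auto simp: space_subprob_algebra measure_pmf.emeasure_space_1
      measure_pmf.finite_measure_axioms intro!: measure_pmf.subprob_space_axioms measure_pmf_in_subprob_algebra\<close>)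

text \<open>Meant for a remainder \<open>f\<close> controlled by an escape probability
  \<open>s\<close> that vanishes to first order.\<close>

lemma has_real_derivative_0_by_bound:
  fixes f s :: "real \<Rightarrow> real"
  assumes s: "(s has_real_derivative 0) (at x within S)" and "s x = 0" and "x \<in> S"
    and bound: "\<And>y. y \<in> S \<Longrightarrow> \<bar>f y\<bar> \<le> B * s y"
  shows "(f has_real_derivative 0) (at x within S)"
proof -
  have "f x = 0" using bound[OF \<open>x \<in> S\<close>] \<open>s x = 0\<close> by simp
  have "((\<lambda>y. \<bar>B\<bar> * \<bar>(s y - s x) / (y - x)\<bar>) \<longlongrightarrow> \<bar>B\<bar> * \<bar>0\<bar>) (at x within S)"
    using s unfolding has_field_derivative_iff by (intro tendsto_intros)
  then have "((\<lambda>y. \<bar>B\<bar> * \<bar>(s y - s x) / (y - x)\<bar>) \<longlongrightarrow> 0) (at x within S)" by simp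
  moreover have "\<forall>\<^sub>F y in at x within S. norm ((f y - f x) / (y - x)) \<le> \<bar>B\<bar> * \<bar>(s y - s x) / (y - x)\<bar>"
    unfolding eventually_at_filter
  proof (intro always_eventually allI impI)
    fix y assume "y \<noteq> x" "y \<in> S"
    have "\<bar>f y\<bar> \<le> \<bar>B\<bar> * \<bar>s y\<bar>" using bound[OF \<open>y \<in> S\<close>] by (simp add: abs_mult[symmetric])
    then show "norm ((f y - f x) / (y - x)) \<le> \<bar>B\<bar> * \<bar>(s y - s x) / (y - x)\<bar>"
      by (simp add: \<open>f x = 0\<close> \<open>s x = 0\<close> abs_mult divide_right_mono)
  qed
  ultimately show ?thesis
    unfolding has_field_derivative_iff by (rule Lim_null_comparison[rotated])
qed

text \<open>The bridge from time 0 to time \<open>t\<close>. The semigroup law covers only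
  increments \<open>h \<ge> 0\<close>, hence the one-sided result.\<close>

lemma has_deriv_shift:
  fixes u w :: "real \<Rightarrow> real"
  assumes "(u has_real_derivative D) (at 0 within {0..})" "\<And>h. 0 \<le> h \<Longrightarrow> w (t + h) = u h"
  shows "(w has_real_derivative D) (at t within {t..})"
proof -
  have img: "(\<lambda>s. s - t) ` {t..} = {0..}"
    by (auto simp: image_iff intro!: bexI[of _ "_ + t"])
  have "((\<lambda>s. u (s - t)) has_real_derivative D * 1) (at t within {t..})"
    by (rule DERIV_image_chain[unfolded o_def, where g = "\<lambda>s. s - t"])
      (use assms(1) in \<open>auto simp: img intro!: derivative_eq_intros\<close>)
  then have "((\<lambda>s. u (s - t)) has_real_derivative D) (at t within {t..})" by simp
  then show ?thesis
    by (rule has_field_derivative_transform_within[where d = 1]) (use assms(2)[of "_ - t"] in auto)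
qed

text \<open>The uniform bound \<open>\<Lambda>\<close> on the total jump rates makes
  \<open>gen v x + \<Lambda> * v x\<close> a combination of values of \<open>v\<close> with
  nonnegative weights, as the maximum principle needs.\<close>

locale birth_death_chain =
  fixes b d :: "nat \<Rightarrow> real" and \<Lambda> :: real and P :: "real \<Rightarrow> nat \<Rightarrow> nat pmf"
  assumes chain: "markov_chain (birth_death_rates b d) P"
    and b_pos: "\<And>x. 0 < b x" and d_0: "d 0 = 0" and d_pos: "\<And>x. 0 < d (Suc x)"
    and rate_le: "\<And>x. b x + d x \<le> \<Lambda>"
begin

text \<open>In state 0 the truncated predecessor carries the weight \<open>d 0 = 0\<close>, so the
  formula is the generator there too.\<close>

definition gen :: "(nat \<Rightarrow> real) \<Rightarrow> nat \<Rightarrow> real" where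
  "gen v x = b x * v (Suc x) + d x * v (x - 1) - (b x + d x) * v x"

definition op :: "real \<Rightarrow> (nat \<Rightarrow> real) \<Rightarrow> nat \<Rightarrow> real" where
  "op t f x = measure_pmf.expectation (P t x) f"

lemma d_nonneg: "0 \<le> d x"
  using d_0 d_pos less_imp_le by (cases x) auto

lemma \<Lambda>_pos: "0 < \<Lambda>"
  using b_pos[of 0] d_nonneg[of 0] rate_le[of 0] by linarith

lemma b_le: "b x \<le> \<Lambda>" and d_le: "d x \<le> \<Lambda>"
  using b_pos[of x] d_nonneg[of x] rate_le[of x] by linarith+

lemma P_0: "P 0 x = return_pmf x"
  using chain by (simp add: markov_chain_def transition_semigroup_def)

lemma P_add: "0 \<le> s \<Longrightarrow> 0 \<le> t \<Longrightarrow> P (s + t) x = bind_pmf (P s x) (P t)"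
  using chain by (simp add: markov_chain_def transition_semigroup_def)

lemma P_deriv:
  "((\<lambda>t. pmf (P t x) y) has_real_derivative birth_death_rates b d x y) (at 0 within {0..})"
  using chain by (simp add: markov_chain_def has_rates_def)

lemma op_0: "op 0 f x = f x"
  by (simp add: op_def P_0)

lemma op_bound: "(\<And>x. \<bar>f x\<bar> \<le> B) \<Longrightarrow> \<bar>op t f x\<bar> \<le> B"
  unfolding op_def by (rule abs_expectation_le)

lemma op_add:
  assumes "0 \<le> s" "0 \<le> t" "\<And>x. \<bar>f x\<bar> \<le> B"
  shows "op (s + t) f x = op s (op t f) x"
  using assms by (simp add: op_def[abs_def] P_add expectation_bind_pmf[where B = B])

lemma op_diff_const:
  assumes "\<And>x. \<bar>f x\<bar> \<le> B"
  shows "op t (\<lambda>x. f x - c) x = op t f x - c"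
  unfolding op_def using integrable_bounded_pmf[of f, OF assms] by simp

lemma pmf_eq_op: "pmf (P t x) y = op t (indicator {y}) x"
  by (simp add: op_def pmf.rep_eq)

text \<open>The rates concern single target states only. The sum over \<open>x\<close> and its
  neighbours is finite and can be differentiated termwise; the mass \<open>s h\<close> outside has
  derivative 0 because the rates out of \<open>x\<close> sum to 0, and a bounded \<open>k\<close>
  inherits this.\<close>

lemma op_deriv_0:
  assumes k: "\<And>x. \<bar>k x\<bar> \<le> B"
  shows "((\<lambda>h. op h k x) has_real_derivative gen k x) (at 0 within {0..})"
proof -
  define S where "S = {x - 1, x, Suc x}"
  have "finite S" by (simp add: S_def)
  define s where "s h = 1 - (\<Sum>y\<in>S. pmf (P h x) y)" for h
  define e where "e h = op h k x - (\<Sum>y\<in>S. pmf (P h x) y * k y)" for h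
  have sum_S: "(\<Sum>y\<in>S. birth_death_rates b d x y * v y) = gen v x" for v
    by (cases x) (auto simp: S_def birth_death_rates_def gen_def d_0 algebra_simps)
  have "(s has_real_derivative 0 - (\<Sum>y\<in>S. birth_death_rates b d x y)) (at 0 within {0..})"
    unfolding s_def by (intro derivative_intros P_deriv)
  moreover have "(\<Sum>y\<in>S. birth_death_rates b d x y) = 0"
    using sum_S[of "\<lambda>_. 1"] by (simp add: gen_def algebra_simps)
  ultimately have s: "(s has_real_derivative 0) (at 0 within {0..})" by simp
  have "s 0 = 0" using \<open>finite S\<close> by (simp add: s_def P_0 S_def indicator_def)
  have "\<bar>e h\<bar> \<le> B * s h" for h
  proof -
    have "op h k x = measure_pmf.expectation (P h x) (\<lambda>y. k y * indicator S y)
        + measure_pmf.expectation (P h x) (\<lambda>y. k y * indicator (- S) y)"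
      unfolding op_def
      by (subst Bochner_Integration.integral_add[symmetric])
        (auto intro!: integrable_bounded_pmf[where B = B] Bochner_Integration.integral_cong
          simp: indicator_def k order_trans[OF abs_ge_zero k])
    also have "measure_pmf.expectation (P h x) (\<lambda>y. k y * indicator S y) = (\<Sum>y\<in>S. pmf (P h x) y * k y)"
      using \<open>finite S\<close> by (subst integral_measure_pmf_real[where A = S]) (auto simp: indicator_def mult.commute)
    finally have "\<bar>e h\<bar> = \<bar>measure_pmf.expectation (P h x) (\<lambda>y. k y * indicator (- S) y)\<bar>"
      by (simp add: e_def)
    also have "\<dots> \<le> measure_pmf.expectation (P h x) (\<lambda>y. \<bar>k y * indicator (- S) y\<bar>)"
      by (rule integral_abs_bound)
    also have "\<dots> \<le> measure_pmf.expectation (P h x) (\<lambda>y. B * indicator (- S) y)"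
      by (intro integral_mono integrable_bounded_pmf[where B = B])
        (auto simp: indicator_def k order_trans[OF abs_ge_zero k] abs_of_nonneg)
    also have "\<dots> = B * (1 - measure_pmf.prob (P h x) S)"
      using measure_pmf.prob_compl[of S "P h x"] by (simp add: Compl_eq_Diff_UNIV)
    also have "\<dots> = B * s h" using \<open>finite S\<close> by (simp add: s_def measure_measure_pmf_finite)
    finally show ?thesis .
  qed
  then have "(e has_real_derivative 0) (at 0 within {0..})"
    by (intro has_real_derivative_0_by_bound[OF s \<open>s 0 = 0\<close>]) auto
  then have "((\<lambda>h. e h + (\<Sum>y\<in>S. pmf (P h x) y * k y)) has_real_derivative
      0 + (\<Sum>y\<in>S. birth_death_rates b d x y * k y)) (at 0 within {0..})"
    by (intro DERIV_add DERIV_sum DERIV_cmult_right P_deriv)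
  then show ?thesis by (simp add: e_def sum_S)
qed

lemma op_deriv:
  assumes "\<And>x. \<bar>f x\<bar> \<le> B" "0 \<le> t"
  shows "((\<lambda>s. op s f x) has_real_derivative gen (op t f) x) (at t within {t..})"
  by (rule has_deriv_shift[OF op_deriv_0[OF op_bound[OF assms(1)]]])
    (use assms in \<open>auto simp: add.commute op_add[symmetric, where B = B]\<close>)

text \<open>By the semigroup law the increment is the mean at time \<open>h\<close> of
  \<open>op t f - op t f x\<close>, which vanishes at \<open>x\<close> itself. The bound does not
  depend on \<open>t\<close>.\<close>

lemma op_increment_le:
  assumes f: "\<And>x. \<bar>f x\<bar> \<le> B" and "0 \<le> t" "0 \<le> h"
  shows "\<bar>op (t + h) f x - op t f x\<bar> \<le> 2 * B * (1 - pmf (P h x) x)"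
proof -
  define k where "k y = op t f y - op t f x" for y
  have k: "\<bar>k y\<bar> \<le> 2 * B" for y
  proof -
    have "\<bar>op t f z\<bar> \<le> B" for z by (intro op_bound f)
    from this[of x] this[of y] show ?thesis by (simp add: k_def)
  qed
  have "op (t + h) f x - op t f x = op h k x"
    using assms unfolding k_def
    by (subst op_diff_const[where B = B]) (auto simp: op_bound add.commute op_add[where B = B, symmetric])
  also have "\<bar>\<dots>\<bar> \<le> measure_pmf.expectation (P h x) (\<lambda>y. \<bar>k y\<bar>)"
    unfolding op_def by (rule integral_abs_bound)
  also have "\<dots> \<le> measure_pmf.expectation (P h x) (\<lambda>y. 2 * B * (1 - indicator {x} y))"
    using k by (intro integral_mono integrable_bounded_pmf[where B = "2 * B"])
      (use order_trans[OF abs_ge_zero f[of x]] in \<open>auto simp: indicator_def k_def\<close>)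
  also have "\<dots> = 2 * B * (1 - pmf (P h x) x)"
  proof -
    have "integrable (measure_pmf (P h x)) (indicator {x} :: nat \<Rightarrow> real)"
      by (rule integrable_bounded_pmf[where B = 1]) (simp add: indicator_def)
    then show ?thesis by (simp add: pmf.rep_eq)
  qed
  finally show ?thesis .
qed

lemma op_continuous:
  assumes f: "\<And>x. \<bar>f x\<bar> \<le> B"
  shows "continuous_on {0..} (\<lambda>t. op t f x)"
proof -
  have lim: "((\<lambda>h. 2 * B * (1 - pmf (P h x) x)) \<longlongrightarrow> 2 * B * (1 - 1)) (at 0 within {0..})"
    using DERIV_continuous[OF P_deriv[of x x]] unfolding continuous_within P_0
    by (intro tendsto_intros) simp
  show ?thesis unfolding continuous_on_iff
  proof (intro ballI allI impI)
    fix t e :: real assume t: "t \<in> {0..}" and "0 < e"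
    from lim have "\<forall>\<^sub>F h in at 0 within {0..}. \<bar>2 * B * (1 - pmf (P h x) x)\<bar> < e"
      using order_tendstoD(2)[OF tendsto_rabs[OF lim], of e] \<open>0 < e\<close> by simp
    then obtain \<delta> where \<delta>: "0 < \<delta>" "\<And>h. 0 < h \<Longrightarrow> h < \<delta> \<Longrightarrow> \<bar>2 * B * (1 - pmf (P h x) x)\<bar> < e"
      by (auto simp: eventually_at)
    \<comment> \<open>The modulus is uniform in the base time \<open>u\<close>, so starting from the
      earlier of two times gives continuity from the left as well.\<close>
    have close: "dist (op (u + h) f x) (op u f x) < e" if "0 \<le> u" "0 \<le> h" "h < \<delta>" for u h
    proof (cases "h = 0")
      case False
      have "\<bar>op (u + h) f x - op u f x\<bar> \<le> 2 * B * (1 - pmf (P h x) x)"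
        using that by (intro op_increment_le f) auto
      with False that \<delta>(2)[of h] show ?thesis by (simp add: dist_real_def)
    qed (use \<open>0 < e\<close> in simp)
    show "\<exists>\<delta>>0. \<forall>t'\<in>{0..}. dist t' t < \<delta> \<longrightarrow> dist (op t' f x) (op t f x) < e"
    proof (intro exI conjI ballI impI)
      fix t' assume "t' \<in> {0..}" "dist t' t < \<delta>"
      with close[of t "t' - t"] close[of t' "t - t'"] t
      show "dist (op t' f x) (op t f x) < e"
        by (cases "t \<le> t'") (auto simp: dist_real_def abs_minus_commute)
    qed (fact \<open>0 < \<delta>\<close>)
  qed
qed

section \<open>Forward equation\<close>

text \<open>The inflow from the neighbours is nonnegative, so by the backward equation
  \<open>exp (\<Lambda> * t) * pmf (P t x) x\<close> cannot decrease. The bound is uniform in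
  \<open>x\<close>, which the forward equation needs for dominated convergence.\<close>

lemma no_jump_probability:
  assumes "0 \<le> t"
  shows "1 - pmf (P t x) x \<le> \<Lambda> * t"
proof -
  have ind: "\<bar>indicator {x} y :: real\<bar> \<le> 1" for y by (simp add: indicator_def)
  have op_nonneg: "0 \<le> op s (indicator {x}) y" for s y by (simp add: pmf_eq_op[symmetric])
  have "- (exp (\<Lambda> * t) * op t (indicator {x}) x) \<le> - (exp (\<Lambda> * 0) * op 0 (indicator {x}) x)"
  proof (rule right_deriv_nonpos_imp_le[where T = t])
    show "continuous_on {0..t} (\<lambda>t. - (exp (\<Lambda> * t) * op t (indicator {x}) x))"
      by (intro continuous_intros continuous_on_subset[OF op_continuous[OF ind]]) auto
    fix s assume s: "0 \<le> s" "s < t"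
    show "((\<lambda>t. - (exp (\<Lambda> * t) * op t (indicator {x}) x)) has_real_derivative
       - (exp (\<Lambda> * s) * (\<Lambda> * op s (indicator {x}) x + gen (op s (indicator {x})) x))) (at s within {s..})"
      using s by (auto intro!: derivative_eq_intros op_deriv[OF ind] simp: algebra_simps)
    have "(b x + d x) * op s (indicator {x}) x \<le> \<Lambda> * op s (indicator {x}) x"
      using op_nonneg rate_le by (intro mult_right_mono) auto
    moreover have "0 \<le> b x * op s (indicator {x}) (Suc x)" "0 \<le> d x * op s (indicator {x}) (x - 1)"
      using op_nonneg b_pos[of x] d_nonneg[of x] by simp_all
    ultimately show "- (exp (\<Lambda> * s) * (\<Lambda> * op s (indicator {x}) x + gen (op s (indicator {x})) x)) \<le> 0"
      by (simp add: gen_def)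
  qed (use assms in auto)
  then have "1 \<le> exp (\<Lambda> * t) * pmf (P t x) x" by (simp add: op_0 pmf_eq_op)
  then have "exp (- (\<Lambda> * t)) \<le> pmf (P t x) x" by (simp add: exp_minus field_simps)
  moreover have "1 + - (\<Lambda> * t) \<le> exp (- (\<Lambda> * t))" by (rule exp_ge_add_one_self)
  ultimately show ?thesis by linarith
qed

lemma pmf_increment_le:
  assumes "0 \<le> t"
  shows "\<bar>pmf (P t x) y - indicator {x} y\<bar> \<le> \<Lambda> * t"
proof (cases "x = y")
  case True
  then show ?thesis using no_jump_probability[OF assms, of x] pmf_le_1[of "P t x" x] by simp
next
  case False
  have "pmf (P t x) x + pmf (P t x) y \<le> 1"
    using measure_pmf.prob_le_1[of "P t x" "{x, y}"] False by (simp add: measure_measure_pmf_finite)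
  with False no_jump_probability[OF assms, of x] show ?thesis by simp
qed

text \<open>The adjoint of \<open>gen\<close>: the right-hand side of the forward equation for a
  mass function \<open>\<mu>\<close>.\<close>

definition influx :: "(nat \<Rightarrow> real) \<Rightarrow> nat \<Rightarrow> real" where
  "influx \<mu> y = (if y = 0 then 0 else b (y - 1) * \<mu> (y - 1)) + d (Suc y) * \<mu> (Suc y) - (b y + d y) * \<mu> y"

text \<open>Differentiation under the mean over the initial state: the quotients converge by the
  rates and are dominated by the constant \<open>\<Lambda>\<close>. A general \<open>\<mu>\<close>
  serves both the forward equation (\<open>\<mu> = P t x\<close>) and the balance equations
  (\<open>\<mu> = \<nu>\<close>).\<close>

lemma forward_deriv_0:
  "((\<lambda>h. pmf (bind_pmf \<mu> (P h)) y) has_real_derivative influx (pmf \<mu>) y) (at 0 within {0..})"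
proof -
  have quot: "(pmf (bind_pmf \<mu> (P h)) y - pmf (bind_pmf \<mu> (P 0)) y) / (h - 0)
      = measure_pmf.expectation \<mu> (\<lambda>x. (pmf (P h x) y - indicator {x} y) / h)" for h
  proof -
    have i: "integrable (measure_pmf \<mu>) (\<lambda>x. pmf (P h x) y)" "integrable (measure_pmf \<mu>) (\<lambda>x. indicator {x} y :: real)"
      by (rule integrable_bounded_pmf[where B = 1], simp add: pmf_le_1 indicator_def)+
    have "pmf (bind_pmf \<mu> (P 0)) y = measure_pmf.expectation \<mu> (\<lambda>x. indicator {x} y)"
      unfolding pmf_bind by (intro Bochner_Integration.integral_cong) (auto simp: P_0 indicator_def)
    with i show ?thesis by (simp add: pmf_bind Bochner_Integration.integral_diff)
  qed
  have "measure_pmf.expectation \<mu> (\<lambda>x. birth_death_rates b d x y)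
      = (\<Sum>x\<in>{y - 1, y, Suc y}. birth_death_rates b d x y * pmf \<mu> x)"
    by (rule integral_measure_pmf_real) (auto simp: birth_death_rates_def split: if_splits)
  also have "\<dots> = influx (pmf \<mu>) y"
    by (cases y) (auto simp: birth_death_rates_def influx_def algebra_simps)
  finally have influx: "influx (pmf \<mu>) y = measure_pmf.expectation \<mu> (\<lambda>x. birth_death_rates b d x y)" ..
  show ?thesis unfolding has_field_derivative_iff quot tendsto_at_iff_sequentially comp_def influx
  proof (intro allI impI)
    fix X :: "nat \<Rightarrow> real" assume X: "\<forall>i. X i \<in> {0..} - {0}" "X \<longlonglongrightarrow> 0"
    show "(\<lambda>i. measure_pmf.expectation \<mu> (\<lambda>x. (pmf (P (X i) x) y - indicator {x} y) / X i))
        \<longlonglongrightarrow> measure_pmf.expectation \<mu> (\<lambda>x. birth_death_rates b d x y)"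
    proof (rule integral_dominated_convergence[where w = "\<lambda>_. \<Lambda>"])
      fix i
      have "0 < X i" using X(1) by (auto simp: less_le)
      then show "AE x in measure_pmf \<mu>. norm ((pmf (P (X i) x) y - indicator {x} y) / X i) \<le> \<Lambda>"
        using pmf_increment_le[of "X i"] by (auto simp: field_simps)
    next
      show "AE x in measure_pmf \<mu>. (\<lambda>i. (pmf (P (X i) x) y - indicator {x} y) / X i)
          \<longlonglongrightarrow> birth_death_rates b d x y"
      proof (rule AE_I2)
        fix x
        have "((\<lambda>h. (pmf (P h x) y - indicator {x} y) / h) \<longlongrightarrow> birth_death_rates b d x y) (at 0 within {0..})"
          using P_deriv[of x y] unfolding has_field_derivative_iff by (simp add: P_0 indicator_def eq_commute)
        with X show "(\<lambda>i. (pmf (P (X i) x) y - indicator {x} y) / X i) \<longlonglongrightarrow> birth_death_rates b d x y"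
          unfolding tendsto_at_iff_sequentially comp_def by blast
      qed
    qed auto
  qed
qed

lemma forward_deriv:
  assumes "0 \<le> t"
  shows "((\<lambda>s. pmf (P s x) y) has_real_derivative influx (pmf (P t x)) y) (at t within {t..})"
  by (rule has_deriv_shift[OF forward_deriv_0]) (use assms in \<open>simp add: P_add\<close>)

end

section \<open>Stationary law, detailed balance and reversibility\<close>

locale stationary_birth_death_chain = birth_death_chain +
  fixes \<nu> :: "nat pmf"
  assumes stationary: "stationary P \<nu>"
begin

lemma bind_\<nu>: "0 \<le> t \<Longrightarrow> bind_pmf \<nu> (P t) = \<nu>"
  using stationary by (simp add: stationary_def law_at_def)

lemma expectation_op:
  assumes "\<And>x. \<bar>f x\<bar> \<le> B" "0 \<le> t"
  shows "measure_pmf.expectation \<nu> (op t f) = measure_pmf.expectation \<nu> f"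
  unfolding op_def[abs_def]
  using expectation_bind_pmf[where f = f and B = B and p = \<nu> and q = "P t"] assms by (simp add: bind_\<nu>)

lemma influx_\<nu>: "influx (pmf \<nu>) y = 0"
proof -
  have "((\<lambda>h. pmf \<nu> y) has_real_derivative influx (pmf \<nu>) y) (at 0 within {0..})"
    by (rule has_field_derivative_transform_within[OF forward_deriv_0[of \<nu> y], where d = 1])
      (auto simp: bind_\<nu>)
  moreover have "((\<lambda>h. pmf \<nu> y) has_real_derivative 0) (at 0 within {0..})" by simp
  moreover have "at (0 :: real) within {0..} \<noteq> bot"
    by (simp add: at_within_Ici_at_right)
  ultimately show ?thesis
    unfolding has_field_derivative_iff by (blast intro: tendsto_unique)
qed

text \<open>Global balance at a state says that the net flows across its two edges agree. State 0
  has no lower edge, so all net flows vanish.\<close>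

lemma detailed_balance: "b x * pmf \<nu> x = d (Suc x) * pmf \<nu> (Suc x)"
proof (induction x)
  case 0
  then show ?case using influx_\<nu>[of 0] by (simp add: influx_def d_0)
next
  case (Suc x)
  then show ?case using influx_\<nu>[of "Suc x"] by (simp add: influx_def algebra_simps)
qed

lemma \<nu>_pos: "0 < pmf \<nu> x"
proof -
  have step: "pmf \<nu> (Suc x) = 0 \<longleftrightarrow> pmf \<nu> x = 0" for x
    using detailed_balance[of x] b_pos[of x] d_pos[of x] by auto
  have "pmf \<nu> x = 0 \<longleftrightarrow> pmf \<nu> 0 = 0" for x by (induction x) (auto simp: step)
  moreover obtain z where "pmf \<nu> z \<noteq> 0" using set_pmf_not_empty[of \<nu>] by (auto simp: set_pmf_iff)
  ultimately have "pmf \<nu> x \<noteq> 0" by metis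
  then show ?thesis by (simp add: less_le)
qed

text \<open>Both sides solve the backward equation: the left one by the forward equation and detailed
  balance.\<close>

lemma reversible:
  assumes "0 \<le> t"
  shows "pmf \<nu> y * pmf (P t y) x = pmf \<nu> x * pmf (P t x) y"
proof -
  define w where "w t x = pmf \<nu> y * pmf (P t y) x / pmf \<nu> x - pmf (P t x) y" for t x
  have ind: "\<bar>indicator {z} y :: real\<bar> \<le> 1" for y z :: nat by (simp add: indicator_def)
  \<comment> \<open>The mass moving from \<open>y\<close> to \<open>x\<close> is part of the
    stationary mass at \<open>x\<close>. This makes \<open>w\<close> bounded, without which the
    maximum principle cannot start.\<close>
  have le: "pmf \<nu> y * pmf (P t y) x \<le> pmf \<nu> x" if "0 \<le> t" for t x
  proof -
    have "pmf \<nu> y * pmf (P t y) x = measure_pmf.expectation \<nu> (\<lambda>z. indicator {y} z * pmf (P t y) x)"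
      by (subst integral_measure_pmf_real[where A = "{y}"]) (auto simp: indicator_def)
    also have "\<dots> \<le> measure_pmf.expectation \<nu> (\<lambda>z. pmf (P t z) x)"
      by (intro integral_mono integrable_bounded_pmf[where B = 1])
        (auto simp: indicator_def pmf_le_1)
    also have "\<dots> = pmf (bind_pmf \<nu> (P t)) x" by (simp add: pmf_bind)
    finally show ?thesis using that by (simp add: bind_\<nu>)
  qed
  \<comment> \<open>With \<open>m0 = 0\<close>, \<open>\<gamma> = 0\<close> and \<open>g = 1\<close>
    the maximum principle is a uniqueness statement for bounded solutions.\<close>
  have "\<bar>w t x\<bar> \<le> 0 * exp (- 0 * t) * (\<lambda>_. 1) x"
  proof (rule maximum_principle[where w = w and A = gen and \<Lambda> = \<Lambda> and B = 2])
    show "continuous_on {0..} (\<lambda>t. w t i)" for i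
      unfolding w_def pmf_eq_op using \<nu>_pos[of i]
      by (intro continuous_intros op_continuous[OF ind]) auto
  next
    fix t :: real and i :: nat assume "0 \<le> t"
    have "pmf \<nu> y * influx (pmf (P t y)) i / pmf \<nu> i = gen (\<lambda>x. pmf \<nu> y * pmf (P t y) x / pmf \<nu> x) i"
    proof -
      have up: "pmf \<nu> y * (d (Suc i) * pmf (P t y) (Suc i)) / pmf \<nu> i
          = b i * (pmf \<nu> y * pmf (P t y) (Suc i) / pmf \<nu> (Suc i))"
      proof -
        have "d (Suc i) = b i * pmf \<nu> i / pmf \<nu> (Suc i)"
          using detailed_balance[of i] \<nu>_pos[of "Suc i"] by (simp add: field_simps)
        then show ?thesis using \<nu>_pos[of i] by simp
      qed
      have down: "pmf \<nu> y * (b (i - 1) * pmf (P t y) (i - 1)) / pmf \<nu> i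
          = d i * (pmf \<nu> y * pmf (P t y) (i - 1) / pmf \<nu> (i - 1))" if "i \<noteq> 0"
      proof -
        have "b (i - 1) = d i * pmf \<nu> i / pmf \<nu> (i - 1)"
          using detailed_balance[of "i - 1"] \<nu>_pos[of "i - 1"] that by (simp add: field_simps)
        then show ?thesis using \<nu>_pos[of i] by simp
      qed
      show ?thesis
        using up down by (cases "i = 0")
          (auto simp: influx_def gen_def d_0 ring_distribs diff_divide_distrib add_divide_distrib mult_ac)
    qed
    moreover have "((\<lambda>s. w s i) has_real_derivative
        (pmf \<nu> y * influx (pmf (P t y)) i / pmf \<nu> i - gen (op t (indicator {y})) i)) (at t within {t..})"
      unfolding w_def using forward_deriv[OF \<open>0 \<le> t\<close>, of y i] op_deriv[where f = "indicator {y}" and x = i, OF ind \<open>0 \<le> t\<close>]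
      by (intro DERIV_diff DERIV_cdivide DERIV_cmult) (simp_all add: pmf_eq_op)
    moreover have "gen (w t) i = gen (\<lambda>x. pmf \<nu> y * pmf (P t y) x / pmf \<nu> x) i - gen (op t (indicator {y})) i"
      by (simp add: gen_def w_def pmf_eq_op algebra_simps)
    ultimately show "((\<lambda>s. w s i) has_real_derivative gen (w t) i) (at t within {t..})" by simp
  next
    fix v :: "nat \<Rightarrow> real" and m :: real and i assume v: "\<And>j. \<bar>v j\<bar> \<le> m * 1"
    have "gen v i + \<Lambda> * v i = b i * v (Suc i) + d i * v (i - 1) + (\<Lambda> - (b i + d i)) * v i"
      by (simp add: gen_def algebra_simps)
    also have "\<bar>\<dots>\<bar> \<le> b i * \<bar>v (Suc i)\<bar> + d i * \<bar>v (i - 1)\<bar> + (\<Lambda> - (b i + d i)) * \<bar>v i\<bar>"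
      using b_pos[of i] d_nonneg[of i] rate_le[of i]
      by (intro order_trans[OF abs_triangle_ineq] add_mono) (auto simp: abs_mult)
    also have "\<dots> \<le> b i * m + d i * m + (\<Lambda> - (b i + d i)) * m"
      using b_pos[of i] d_nonneg[of i] rate_le[of i] v by (intro add_mono mult_left_mono) auto
    finally show "\<bar>gen v i + \<Lambda> * v i\<bar> \<le> (\<Lambda> - 0) * (m * 1)" by (simp add: algebra_simps)
  next
    fix i show "\<bar>w 0 i\<bar> \<le> 0 * 1"
      using \<nu>_pos[of i] by (auto simp: w_def P_0 indicator_def)
  next
    fix t :: real and i :: nat assume "0 \<le> t"
    have "pmf \<nu> y * pmf (P t y) i / pmf \<nu> i \<le> 1" "0 \<le> pmf \<nu> y * pmf (P t y) i / pmf \<nu> i"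
      using le[OF \<open>0 \<le> t\<close>, of i] \<nu>_pos[of i] by simp_all
    then show "\<bar>w t i\<bar> \<le> 2 * 1"
      using pmf_le_1[of "P t i" y] pmf_nonneg[of "P t i" y] unfolding w_def by linarith
  qed (use \<Lambda>_pos assms in auto)
  then have "w t x = 0" by simp
  then show ?thesis using \<nu>_pos[of x] by (simp add: w_def field_simps)
qed

end

section \<open>Decay of the mean from a test function\<close>

lemma abs_square_le:
  fixes x B :: real
  assumes "\<bar>x\<bar> \<le> B"
  shows "\<bar>x\<^sup>2\<bar> \<le> B\<^sup>2"
  using power_mono[OF assms, of 2] by simp

lemma
  assumes "chi_sq_finite p q"
  shows integrable_density_ratio: "integrable (measure_pmf q) (\<lambda>x. ((pmf p x - pmf q x) / pmf q x)\<^sup>2)"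
    and expectation_density_ratio: "measure_pmf.expectation q (\<lambda>x. ((pmf p x - pmf q x) / pmf q x)\<^sup>2) = chi_sq p q"
proof -
  have eq: "pmf q x * ((pmf p x - pmf q x) / pmf q x)\<^sup>2 = (pmf p x - pmf q x)\<^sup>2 / pmf q x" for x
    by (simp add: power2_eq_square)
  have "(\<lambda>x. (pmf p x - pmf q x)\<^sup>2 / pmf q x) summable_on UNIV"
    using assms by (simp add: chi_sq_finite_def)
  then have "Infinite_Set_Sum.abs_summable_on (\<lambda>x. (pmf p x - pmf q x)\<^sup>2 / pmf q x) UNIV"
    by (simp only: abs_summable_equivalent summable_on_iff_abs_summable_on_real)
  moreover from this have "infsetsum (\<lambda>x. (pmf p x - pmf q x)\<^sup>2 / pmf q x) UNIV = chi_sq p q"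
    unfolding chi_sq_def by (rule infsetsum_infsum)
  ultimately show "integrable (measure_pmf q) (\<lambda>x. ((pmf p x - pmf q x) / pmf q x)\<^sup>2)"
    "measure_pmf.expectation q (\<lambda>x. ((pmf p x - pmf q x) / pmf q x)\<^sup>2) = chi_sq p q"
    unfolding measure_pmf_eq_density
    by (simp_all add: integrable_density integral_density eq infsetsum_def
        Infinite_Set_Sum.abs_summable_on_def)
qed

lemma chi_sq_nonneg: "0 \<le> chi_sq p q"
  unfolding chi_sq_def by (intro infsum_nonneg) simp

lemma chi_nonneg: "0 \<le> chi p q"
  by (simp add: chi_def chi_sq_nonneg)

lemma expectation_diff_le_chi:
  fixes k :: "'a \<Rightarrow> real"
  assumes fin: "chi_sq_finite p q" and k: "\<And>x. \<bar>k x\<bar> \<le> B"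
  shows "\<bar>measure_pmf.expectation p k - measure_pmf.expectation q k\<bar>
    \<le> sqrt (measure_pmf.expectation q (\<lambda>x. (k x)\<^sup>2)) * chi p q"
proof -
  define a where "a x = (pmf p x - pmf q x) / pmf q x" for x
  have abs_cont: "pmf p x = 0" if "pmf q x = 0" for x
    using fin that by (auto simp: chi_sq_finite_def pmf_eq_0_set_pmf)
  have int_k: "integrable (measure_pmf p) k" "integrable (measure_pmf q) k"
    by (rule integrable_bounded_pmf[OF k])+
  have int_k2: "integrable (measure_pmf q) (\<lambda>x. (k x)\<^sup>2)"
    by (rule integrable_bounded_pmf[OF abs_square_le[OF k]])
  have int_a2: "integrable (measure_pmf q) (\<lambda>x. (a x)\<^sup>2)"
    unfolding a_def by (rule integrable_density_ratio[OF fin])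
  \<comment> \<open>Where \<open>pmf q x = 0\<close> the quotient \<open>a x\<close> is 0 by
    convention, and absolute continuity makes the right-hand side vanish too.\<close>
  have ratio: "pmf q x * (a x * k x) = pmf p x * k x - pmf q x * k x" for x
    using abs_cont[of x] by (cases "pmf q x = 0") (auto simp: a_def left_diff_distrib)
  have int_pk: "integrable (count_space UNIV) (\<lambda>x. pmf p x * k x)"
    "integrable (count_space UNIV) (\<lambda>x. pmf q x * k x)"
    using int_k unfolding measure_pmf_eq_density by (simp_all add: integrable_density)
  have int_ak: "integrable (measure_pmf q) (\<lambda>x. a x * k x)"
    unfolding measure_pmf_eq_density using int_pk by (simp add: integrable_density ratio)
  have "measure_pmf.expectation q (\<lambda>x. a x * k x) = measure_pmf.expectation p k - measure_pmf.expectation q k"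
    unfolding measure_pmf_eq_density using int_pk by (simp add: integral_density ratio)
  moreover have "(measure_pmf.expectation q (\<lambda>x. a x * k x))\<^sup>2 \<le> chi_sq p q * measure_pmf.expectation q (\<lambda>x. (k x)\<^sup>2)"
    using cauchy_schwarz_integral[OF int_a2 int_k2 int_ak] expectation_density_ratio[OF fin]
    by (simp add: a_def)
  ultimately show ?thesis
    by (metis chi_def mult.commute real_sqrt_abs real_sqrt_le_mono real_sqrt_mult)
qed

context birth_death_chain
begin

text \<open>The increments of a solution of the backward equation solve a linear system with nonnegative
  off-diagonal coefficients, for which \<open>g\<close> is a supersolution decaying at rate \<open>\<gamma>\<close>.\<close>

lemma lipschitz_contraction:
  assumes g_ge: "\<And>i. 1 \<le> g i" and "0 \<le> \<gamma>"
    and g: "\<And>i. b (Suc i) * g (Suc i) - (b i + d (Suc i)) * g i + d i * g (i - 1) \<le> - \<gamma> * g i"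
    and f: "\<And>x. \<bar>f x\<bar> \<le> B" and f_lip: "\<And>i. \<bar>f (Suc i) - f i\<bar> \<le> g i" and "0 \<le> t"
  shows "\<bar>op t f (Suc i) - op t f i\<bar> \<le> exp (- \<gamma> * t) * g i"
proof -
  define w where "w t i = op t f (Suc i) - op t f i" for t i
  define A where "A v i = b (Suc i) * v (Suc i) - (b i + d (Suc i)) * v i + d i * v (i - 1)"
    for v :: "nat \<Rightarrow> real" and i
  have "\<bar>w t i\<bar> \<le> 1 * exp (- \<gamma> * t) * g i"
  \<comment> \<open>The diagonal coefficient \<open>b i + d (Suc i)\<close> mixes the rates of two
    states, hence \<open>2 * \<Lambda>\<close>; the added \<open>\<gamma>\<close> makes the constant
    exceed \<open>\<gamma>\<close>. The crude bound \<open>2 * B\<close> is relative to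
    \<open>g\<close> because \<open>1 \<le> g\<close>.\<close>
  proof (rule maximum_principle[where w = w and A = A and \<Lambda> = "2 * \<Lambda> + \<gamma>" and B = "2 * B"])
    show "continuous_on {0..} (\<lambda>t. w t i)" for i
      unfolding w_def by (intro continuous_intros op_continuous[OF f])
  next
    fix t :: real and i :: nat assume "0 \<le> t"
    have "gen (op t f) (Suc i) - gen (op t f) i = A (w t) i"
      by (cases i) (auto simp: gen_def A_def w_def d_0 algebra_simps)
    moreover have "((\<lambda>s. w s i) has_real_derivative
        (gen (op t f) (Suc i) - gen (op t f) i)) (at t within {t..})"
      unfolding w_def by (intro DERIV_diff op_deriv[OF f \<open>0 \<le> t\<close>])
    ultimately show "((\<lambda>s. w s i) has_real_derivative A (w t) i) (at t within {t..})" by simp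
  next
    fix v :: "nat \<Rightarrow> real" and m :: real and i assume v: "\<And>j. \<bar>v j\<bar> \<le> m * g j"
    define c where "c = 2 * \<Lambda> + \<gamma> - (b i + d (Suc i))"
    have "0 \<le> c" using b_le[of i] d_le[of "Suc i"] \<open>0 \<le> \<gamma>\<close> by (simp add: c_def)
    have "0 \<le> m" using order_trans[OF abs_ge_zero v[of i]] g_ge[of i] by (simp add: zero_le_mult_iff)
    have "A v i + (2 * \<Lambda> + \<gamma>) * v i = b (Suc i) * v (Suc i) + d i * v (i - 1) + c * v i"
      by (simp add: A_def c_def algebra_simps)
    also have "\<bar>\<dots>\<bar> \<le> b (Suc i) * \<bar>v (Suc i)\<bar> + d i * \<bar>v (i - 1)\<bar> + c * \<bar>v i\<bar>"
      using b_pos[of "Suc i"] d_nonneg[of i] \<open>0 \<le> c\<close>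
      by (intro order_trans[OF abs_triangle_ineq] add_mono) (auto simp: abs_mult)
    also have "\<dots> \<le> b (Suc i) * (m * g (Suc i)) + d i * (m * g (i - 1)) + c * (m * g i)"
      using b_pos[of "Suc i"] d_nonneg[of i] \<open>0 \<le> c\<close> v by (intro add_mono mult_left_mono) auto
    also have "\<dots> = m * (b (Suc i) * g (Suc i) - (b i + d (Suc i)) * g i + d i * g (i - 1))
        + (2 * \<Lambda> + \<gamma>) * (m * g i)"
      by (simp add: c_def algebra_simps)
    also have "\<dots> \<le> m * (- \<gamma> * g i) + (2 * \<Lambda> + \<gamma>) * (m * g i)"
      by (intro add_mono mult_left_mono g \<open>0 \<le> m\<close> order_refl)
    finally show "\<bar>A v i + (2 * \<Lambda> + \<gamma>) * v i\<bar> \<le> (2 * \<Lambda> + \<gamma> - \<gamma>) * (m * g i)"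
      by (simp add: algebra_simps)
  next
    show "\<bar>w 0 i\<bar> \<le> 1 * g i" for i using f_lip[of i] by (simp add: w_def op_0)
  next
    fix t :: real and i :: nat
    have op_le: "\<bar>op t f x\<bar> \<le> B" for x by (intro op_bound f)
    have "\<bar>w t i\<bar> \<le> 2 * B" using op_le[of i] op_le[of "Suc i"] by (simp add: w_def)
    also have "\<dots> \<le> 2 * B * g i"
      using g_ge[of i] order_trans[OF abs_ge_zero f[of 0]] mult_left_mono[of 1 "g i" "2 * B"] by simp
    finally show "\<bar>w t i\<bar> \<le> 2 * B * g i" .
  qed (use \<Lambda>_pos \<open>0 \<le> \<gamma>\<close> \<open>0 \<le> t\<close> g_ge in \<open>auto intro: less_le_trans[OF zero_less_one]\<close>)
  then show ?thesis by (simp add: w_def)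
qed

end

context stationary_birth_death_chain
begin

text \<open>\<open>J\<close> is the joint law of the stationary chain at times 0 and
  \<open>t\<close>. Reversibility makes it invariant under swapping the coordinates, so
  \<open>op t\<close> is self-adjoint.\<close>

lemma reversible_expectation:
  assumes f: "\<And>x. \<bar>f x\<bar> \<le> B" and h: "\<And>x. \<bar>h x\<bar> \<le> B" and "0 \<le> t"
  shows "measure_pmf.expectation \<nu> (\<lambda>x. h x * op t f x) = measure_pmf.expectation \<nu> (\<lambda>x. f x * op t h x)"
proof -
  define J where "J = bind_pmf \<nu> (\<lambda>x. map_pmf (Pair x) (P t x))"
  have J: "measure_pmf.expectation J (\<lambda>z. h (fst z) * f (snd z)) = measure_pmf.expectation \<nu> (\<lambda>x. h x * op t f x)"
    if f: "\<And>x. \<bar>f x\<bar> \<le> B" and h: "\<And>x. \<bar>h x\<bar> \<le> B" for f h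
  proof -
    have "\<bar>h (fst z) * f (snd z)\<bar> \<le> B * B" for z
      unfolding abs_mult by (intro mult_mono f h order_trans[OF abs_ge_zero f]) auto
    then show ?thesis
      unfolding J_def op_def by (subst expectation_bind_pmf[where B = "B * B"]) auto
  qed
  have pmf_J: "pmf J (x, y) = pmf \<nu> x * pmf (P t x) y" for x y
  proof -
    have "pmf (map_pmf (Pair z) (P t z)) (x, y) = indicator {x} z * pmf (P t x) y" for z
    proof (cases "z = x")
      case True
      have "pmf (map_pmf (Pair x) (P t x)) (Pair x y) = pmf (P t x) y"
        by (rule pmf_map_inj') (simp add: inj_on_def)
      with True show ?thesis by simp
    next
      case False
      then have "(x, y) \<notin> Pair z ` set_pmf (P t z)" by auto
      with False show ?thesis by (simp add: pmf_map_outside)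
    qed
    then show ?thesis
      unfolding J_def pmf_bind
      by (simp add: pmf.rep_eq)
  qed
  have "map_pmf prod.swap J = J"
  proof (rule pmf_eqI)
    fix z :: "nat \<times> nat"
    obtain x y where z: "z = (x, y)" by (cases z)
    have "pmf (map_pmf prod.swap J) (prod.swap (y, x)) = pmf J (y, x)"
      by (rule pmf_map_inj') simp
    then show "pmf (map_pmf prod.swap J) z = pmf J z"
      using reversible[OF \<open>0 \<le> t\<close>, of x y] by (simp add: z pmf_J)
  qed
  then have "measure_pmf.expectation J (\<lambda>z. h (fst z) * f (snd z))
      = measure_pmf.expectation (map_pmf prod.swap J) (\<lambda>z. h (fst z) * f (snd z))" by simp
  also have "\<dots> = measure_pmf.expectation J (\<lambda>z. f (fst z) * h (snd z))"
    by (simp add: mult.commute)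
  finally show ?thesis using J f h by simp
qed

text \<open>Self-adjointness turns the squared norm of \<open>op t f\<close> into the inner product
  of \<open>f\<close> and \<open>op (2 * t) f\<close>, to which Cauchy-Schwarz applies. This takes
  the place of a spectral decomposition.\<close>

lemma second_moment_doubling:
  assumes f: "\<And>x. \<bar>f x\<bar> \<le> B" and "0 \<le> t"
  defines "\<phi> \<equiv> \<lambda>t. measure_pmf.expectation \<nu> (\<lambda>x. (op t f x)\<^sup>2)"
  shows "(\<phi> t)\<^sup>2 \<le> \<phi> 0 * \<phi> (2 * t)"
proof -
  have op_le: "\<bar>op s f x\<bar> \<le> B" for s x by (intro op_bound f)
  have int: "integrable (measure_pmf \<nu>) (\<lambda>x. op s f x * op r f x)" for s r
    by (rule integrable_bounded_pmf[where B = "B * B"])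
      (unfold abs_mult, intro mult_mono op_le order_trans[OF abs_ge_zero f] abs_ge_zero)
  have "\<phi> t = measure_pmf.expectation \<nu> (\<lambda>x. f x * op t (op t f) x)"
    unfolding \<phi>_def power2_eq_square by (rule reversible_expectation[OF f op_le \<open>0 \<le> t\<close>])
  also have "\<dots> = measure_pmf.expectation \<nu> (\<lambda>x. op 0 f x * op (2 * t) f x)"
    using op_add[where s = t and t = t and f = f, OF \<open>0 \<le> t\<close> \<open>0 \<le> t\<close> f] by (simp add: op_0)
  also have "\<dots>\<^sup>2 \<le> \<phi> 0 * \<phi> (2 * t)"
    unfolding \<phi>_def using int by (intro cauchy_schwarz_integral) (simp_all add: power2_eq_square)
  finally show ?thesis .
qed

text \<open>Summing the decaying increments from 0 bounds \<open>op t f x - op t f 0\<close> by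
  \<open>exp (- \<gamma> * t)\<close> times the primitive \<open>F\<close> of \<open>g\<close>;
  averaging over \<open>\<nu>\<close>, under which \<open>op t f\<close> keeps the mean
  \<open>m\<close>, replaces \<open>op t f 0\<close> by \<open>m\<close>. Square integrability of
  \<open>F\<close> makes the resulting constant finite, and doubling then discards it.\<close>

lemma variance_decay:
  assumes g_ge: "\<And>i. 1 \<le> g i" and "0 \<le> \<gamma>"
    and g: "\<And>i. b (Suc i) * g (Suc i) - (b i + d (Suc i)) * g i + d i * g (i - 1) \<le> - \<gamma> * g i"
    and int: "integrable (measure_pmf \<nu>) (\<lambda>x. (\<Sum>k<x. g k)\<^sup>2)"
    and f: "\<And>x. \<bar>f x\<bar> \<le> B" and f_lip: "\<And>i. \<bar>f (Suc i) - f i\<bar> \<le> g i" and "0 \<le> T"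
  defines "m \<equiv> measure_pmf.expectation \<nu> f"
  shows "measure_pmf.expectation \<nu> (\<lambda>x. (op T f x - m)\<^sup>2)
    \<le> measure_pmf.expectation \<nu> (\<lambda>x. (f x - m)\<^sup>2) * exp (- (2 * \<gamma>) * T)"
proof -
  define k where "k x = f x - m" for x
  define F where "F x = (\<Sum>i<x. g i)" for x
  have "\<bar>m\<bar> \<le> B" unfolding m_def by (rule abs_expectation_le[OF f])
  have k: "\<bar>k x\<bar> \<le> 2 * B" for x
    using f[of x] \<open>\<bar>m\<bar> \<le> B\<close> by (simp add: k_def)
  have op_k: "op t k x = op t f x - m" for t x
    unfolding k_def by (rule op_diff_const[OF f])
  have "integrable (measure_pmf \<nu>) (\<lambda>x. (F x)\<^sup>2)" using int by (simp add: F_def)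
  then have int_F: "integrable (measure_pmf \<nu>) F"
    by (rule measure_pmf.square_integrable_imp_integrable[rotated]) auto
  define c where "c = measure_pmf.expectation \<nu> F"
  have int_Fc: "integrable (measure_pmf \<nu>) (\<lambda>x. (F x + c)\<^sup>2)"
    unfolding power2_sum using int_F \<open>integrable (measure_pmf \<nu>) (\<lambda>x. (F x)\<^sup>2)\<close> by simp
  define \<phi> where "\<phi> t = measure_pmf.expectation \<nu> (\<lambda>x. (op t k x)\<^sup>2)" for t
  define C where "C = measure_pmf.expectation \<nu> (\<lambda>x. (F x + c)\<^sup>2)"
  have pointwise: "\<bar>op t k x\<bar> \<le> exp (- \<gamma> * t) * (F x + c)" if "0 \<le> t" for t x
  proof -
    have diff: "\<bar>op t f x - op t f 0\<bar> \<le> exp (- \<gamma> * t) * F x" for x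
    proof (induction x)
      case (Suc x)
      have "\<bar>op t f (Suc x) - op t f x\<bar> \<le> exp (- \<gamma> * t) * g x"
        by (rule lipschitz_contraction[OF g_ge \<open>0 \<le> \<gamma>\<close> g f f_lip \<open>0 \<le> t\<close>])
      with Suc show ?case by (simp add: F_def algebra_simps)
    qed (simp add: F_def)
    have bd: "\<bar>op t f x\<bar> \<le> B" for x by (intro op_bound f)
    have int_op: "integrable (measure_pmf \<nu>) (op t f)" by (rule integrable_bounded_pmf[OF bd])
    have "\<bar>m - op t f 0\<bar> = \<bar>measure_pmf.expectation \<nu> (\<lambda>x. op t f x - op t f 0)\<bar>"
      using expectation_op[OF f \<open>0 \<le> t\<close>] int_op by (simp add: m_def)
    also have "\<dots> \<le> measure_pmf.expectation \<nu> (\<lambda>x. \<bar>op t f x - op t f 0\<bar>)"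
      by (rule integral_abs_bound)
    also have "\<dots> \<le> measure_pmf.expectation \<nu> (\<lambda>x. exp (- \<gamma> * t) * F x)"
      using diff int_op int_F by (intro integral_mono) auto
    finally show ?thesis using diff[of x] by (simp add: c_def op_k algebra_simps)
  qed
  have "\<phi> T \<le> \<phi> 0 * exp (- (2 * \<gamma>) * T)"
  proof (rule decay_constant_from_doubling[where C = C])
    show "0 \<le> \<phi> t" for t by (simp add: \<phi>_def)
    show "(\<phi> t)\<^sup>2 \<le> \<phi> 0 * \<phi> (2 * t)" if "0 \<le> t" for t
      unfolding \<phi>_def by (rule second_moment_doubling[OF k that])
    show "\<phi> t \<le> C * exp (- (2 * \<gamma>) * t)" if "0 \<le> t" for t
    proof -
      have "(op t k x)\<^sup>2 \<le> exp (- (2 * \<gamma>) * t) * (F x + c)\<^sup>2" for x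
      proof -
        have "\<bar>op t k x\<bar>\<^sup>2 \<le> (exp (- \<gamma> * t) * (F x + c))\<^sup>2"
          by (intro power_mono pointwise that) simp
        also have "\<dots> = exp (- (2 * \<gamma>) * t) * (F x + c)\<^sup>2"
          by (simp add: power_mult_distrib exp_double[symmetric])
        finally show ?thesis by simp
      qed
      moreover have "integrable (measure_pmf \<nu>) (\<lambda>x. (op t k x)\<^sup>2)"
      proof (rule integrable_bounded_pmf)
        show "\<bar>(op t k x)\<^sup>2\<bar> \<le> (2 * B)\<^sup>2" for x by (intro abs_square_le op_bound k)
      qed
      ultimately have "\<phi> t \<le> measure_pmf.expectation \<nu> (\<lambda>x. exp (- (2 * \<gamma>) * t) * (F x + c)\<^sup>2)"
        unfolding \<phi>_def using int_Fc by (intro integral_mono) auto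
      then show ?thesis by (simp add: C_def mult.commute)
    qed
  qed fact
  then show ?thesis by (simp add: \<phi>_def op_k op_0 k_def)
qed

text \<open>The test function enters the bound only through its rate. The prefactor is a second
  moment of \<open>f\<close> about an arbitrary centre \<open>a\<close>, since the variance is the
  smallest such moment.\<close>

lemma bounded_mean_decay:
  assumes g_ge: "\<And>i. 1 \<le> g i" and "0 \<le> \<gamma>"
    and g: "\<And>i. b (Suc i) * g (Suc i) - (b i + d (Suc i)) * g i + d i * g (i - 1) \<le> - \<gamma> * g i"
    and int: "integrable (measure_pmf \<nu>) (\<lambda>x. (\<Sum>k<x. g k)\<^sup>2)"
    and f: "\<And>x. \<bar>f x\<bar> \<le> B" and f_lip: "\<And>i. \<bar>f (Suc i) - f i\<bar> \<le> g i" and "0 \<le> t"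
    and fin: "chi_sq_finite \<pi> \<nu>"
  shows "\<bar>measure_pmf.expectation (law_at P \<pi> t) f - measure_pmf.expectation \<nu> f\<bar>
    \<le> exp (- \<gamma> * t) * sqrt (measure_pmf.expectation \<nu> (\<lambda>x. (f x - a)\<^sup>2)) * chi \<pi> \<nu>"
proof -
  define m where "m = measure_pmf.expectation \<nu> f"
  have bd: "\<bar>op t f x\<bar> \<le> B" for x by (intro op_bound f)
  have "\<bar>m\<bar> \<le> B" unfolding m_def by (rule abs_expectation_le[OF f])
  then have bd': "\<bar>op t f x - m\<bar> \<le> 2 * B" for x using bd[of x] by simp
  have int_op: "integrable (measure_pmf p) (op t f)" for p by (rule integrable_bounded_pmf[OF bd])
  have int_f: "integrable (measure_pmf p) f" for p by (rule integrable_bounded_pmf[OF f])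
  have int_f2: "integrable (measure_pmf p) (\<lambda>x. (f x)\<^sup>2)" for p
    by (rule integrable_bounded_pmf[OF abs_square_le[OF f]])
  have "measure_pmf.expectation (law_at P \<pi> t) f = measure_pmf.expectation \<pi> (op t f)"
    unfolding law_at_def op_def[abs_def] by (rule expectation_bind_pmf[OF f])
  then have "\<bar>measure_pmf.expectation (law_at P \<pi> t) f - m\<bar>
      = \<bar>measure_pmf.expectation \<pi> (\<lambda>x. op t f x - m) - measure_pmf.expectation \<nu> (\<lambda>x. op t f x - m)\<bar>"
    using int_op expectation_op[OF f \<open>0 \<le> t\<close>] by (simp add: m_def)
  also have "\<dots> \<le> sqrt (measure_pmf.expectation \<nu> (\<lambda>x. (op t f x - m)\<^sup>2)) * chi \<pi> \<nu>"
    by (rule expectation_diff_le_chi[OF fin bd'])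
  also have "\<dots> \<le> sqrt (measure_pmf.expectation \<nu> (\<lambda>x. (f x - a)\<^sup>2) * exp (- (2 * \<gamma>) * t)) * chi \<pi> \<nu>"
  proof (intro mult_right_mono real_sqrt_le_mono chi_nonneg)
    have "measure_pmf.expectation \<nu> (\<lambda>x. (f x - c)\<^sup>2)
        = measure_pmf.expectation \<nu> (\<lambda>x. (f x)\<^sup>2) - 2 * c * m + c\<^sup>2" for c
      unfolding power2_diff using int_f int_f2 by (simp add: m_def)
    then have "measure_pmf.expectation \<nu> (\<lambda>x. (f x - m)\<^sup>2)
        = measure_pmf.expectation \<nu> (\<lambda>x. (f x - a)\<^sup>2) - (a - m)\<^sup>2"
      by (simp only: power2_diff) (simp add: power2_eq_square)
    then have "measure_pmf.expectation \<nu> (\<lambda>x. (f x - m)\<^sup>2) \<le> measure_pmf.expectation \<nu> (\<lambda>x. (f x - a)\<^sup>2)"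
      by simp
    then have "measure_pmf.expectation \<nu> (\<lambda>x. (f x - m)\<^sup>2) * exp (- (2 * \<gamma>) * t)
        \<le> measure_pmf.expectation \<nu> (\<lambda>x. (f x - a)\<^sup>2) * exp (- (2 * \<gamma>) * t)"
      by (rule mult_right_mono) simp
    from order_trans[OF variance_decay[OF g_ge \<open>0 \<le> \<gamma>\<close> g int f f_lip \<open>0 \<le> t\<close>, folded m_def] this]
    show "measure_pmf.expectation \<nu> (\<lambda>x. (op t f x - m)\<^sup>2)
        \<le> measure_pmf.expectation \<nu> (\<lambda>x. (f x - a)\<^sup>2) * exp (- (2 * \<gamma>) * t)"
      .
  qed
  also have "exp (- (2 * \<gamma>) * t) = (exp (- \<gamma> * t))\<^sup>2" by (simp add: exp_double[symmetric])
  finally show ?thesis by (simp add: m_def real_sqrt_mult mult_ac)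
qed

text \<open>The truncations \<open>min x N\<close> are bounded and 1-Lipschitz, hence admissible
  because \<open>1 \<le> g\<close>. Their bounds are uniform in \<open>N\<close>: monotone
  convergence gives integrability at time \<open>t\<close>, and the limit in \<open>N\<close> gives
  the estimate.\<close>

lemma mean_decay:
  assumes g_ge: "\<And>i. 1 \<le> g i" and "0 \<le> \<gamma>"
    and g: "\<And>i. b (Suc i) * g (Suc i) - (b i + d (Suc i)) * g i + d i * g (i - 1) \<le> - \<gamma> * g i"
    and int: "integrable (measure_pmf \<nu>) (\<lambda>x. (\<Sum>k<x. g k)\<^sup>2)"
    and int_sq: "integrable (measure_pmf \<nu>) (\<lambda>x. (real x - real a)\<^sup>2)"
    and "0 \<le> t" and fin: "chi_sq_finite \<pi> \<nu>"
  defines "R \<equiv> exp (- \<gamma> * t) * sqrt (measure_pmf.expectation \<nu> (\<lambda>x. (real x - real a)\<^sup>2)) * chi \<pi> \<nu>"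
  shows "integrable (measure_pmf \<nu>) real" "integrable (measure_pmf (law_at P \<pi> t)) real"
    "\<bar>measure_pmf.expectation (law_at P \<pi> t) real - measure_pmf.expectation \<nu> real\<bar> \<le> R"
proof -
  define f where "f N x = real (min x N)" for N x :: nat
  define E where "E N = measure_pmf.expectation (law_at P \<pi> t) (f N)" for N
  have f: "\<bar>f N x\<bar> \<le> real N" for N x by (simp add: f_def)
  have int_f: "integrable (measure_pmf p) (f N)" for p N by (rule integrable_bounded_pmf[OF f])
  have f_lip: "\<bar>f N (Suc i) - f N i\<bar> \<le> g i" for N i
  proof -
    have "\<bar>f N (Suc i) - f N i\<bar> \<le> 1" by (auto simp: f_def min_def)
    with g_ge[of i] show ?thesis by linarith
  qed
  have f_mono: "mono (\<lambda>N. f N x)" for x by (auto simp: mono_def f_def)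
  have f_lim: "(\<lambda>N. f N x) \<longlonglongrightarrow> real x" for x
  proof (rule tendsto_eventually)
    show "\<forall>\<^sub>F N in sequentially. f N x = real x"
      using eventually_ge_at_top[of x] by eventually_elim (simp add: f_def)
  qed
  have "integrable (measure_pmf \<nu>) (\<lambda>x. real x - real a)"
    using int_sq by (rule measure_pmf.square_integrable_imp_integrable[rotated]) auto
  then have "integrable (measure_pmf \<nu>) (\<lambda>x. (real x - real a) + real a)"
    by (intro Bochner_Integration.integrable_add) auto
  then show int_\<nu>: "integrable (measure_pmf \<nu>) real" by simp
  \<comment> \<open>Cutting at a level \<open>N \<ge> a\<close> moves no point away from
    \<open>a\<close>, so the second moment does not grow.\<close>
  have bound: "\<bar>E N - measure_pmf.expectation \<nu> (f N)\<bar> \<le> R" if "a \<le> N" for N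
  proof -
    have "\<bar>f N x - real a\<bar> \<le> \<bar>real x - real a\<bar>" for x
      using that by (auto simp: f_def min_def)
    then have sq: "(f N x - real a)\<^sup>2 \<le> (real x - real a)\<^sup>2" for x
      by (simp add: abs_le_square_iff)
    have "integrable (measure_pmf \<nu>) (\<lambda>x. (f N x - real a)\<^sup>2)"
      by (rule Bochner_Integration.integrable_bound[OF int_sq]) (use sq in auto)
    with sq int_sq have le: "measure_pmf.expectation \<nu> (\<lambda>x. (f N x - real a)\<^sup>2)
        \<le> measure_pmf.expectation \<nu> (\<lambda>x. (real x - real a)\<^sup>2)"
      by (intro integral_mono) auto
    have "\<bar>E N - measure_pmf.expectation \<nu> (f N)\<bar>
        \<le> exp (- \<gamma> * t) * sqrt (measure_pmf.expectation \<nu> (\<lambda>x. (f N x - real a)\<^sup>2)) * chi \<pi> \<nu>"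
      unfolding E_def
      by (rule bounded_mean_decay[OF g_ge \<open>0 \<le> \<gamma>\<close> g int f f_lip \<open>0 \<le> t\<close> fin])
    also have "\<dots> \<le> R"
      unfolding R_def using le by (intro mult_right_mono mult_left_mono real_sqrt_le_mono chi_nonneg) auto
    finally show ?thesis .
  qed
  have "incseq E"
    unfolding E_def using f_mono by (intro incseq_SucI integral_mono int_f) (auto simp: incseq_def)
  have E_nonneg: "0 \<le> E N" for N unfolding E_def by (intro integral_nonneg_AE) (simp add: f_def)
  have E_le: "E N \<le> measure_pmf.expectation \<nu> real + R" for N
  proof -
    have "E N \<le> E (max a N)" using \<open>incseq E\<close> by (simp add: incseq_def)
    also have "\<dots> \<le> measure_pmf.expectation \<nu> (f (max a N)) + R"
      using bound[of "max a N"] by simp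
    also have "measure_pmf.expectation \<nu> (f (max a N)) \<le> measure_pmf.expectation \<nu> real"
      by (intro integral_mono int_f int_\<nu>) (simp add: f_def)
    finally show ?thesis by simp
  qed
  then obtain L where L: "E \<longlonglongrightarrow> L"
    using \<open>incseq E\<close> incseq_convergent[of E] by blast
  show int_law: "integrable (measure_pmf (law_at P \<pi> t)) real"
    by (rule integrable_monotone_convergence[OF int_f[of _ ]])
      (use f_mono f_lim L in \<open>auto simp: E_def[abs_def]\<close>)
  have lim: "(\<lambda>N. measure_pmf.expectation p (f N)) \<longlonglongrightarrow> measure_pmf.expectation p real"
    if "integrable (measure_pmf p) real" for p
    by (rule integral_dominated_convergence[where w = real]) (use that f_lim in \<open>auto simp: f_def\<close>)
  have "(\<lambda>N. \<bar>E N - measure_pmf.expectation \<nu> (f N)\<bar>)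
      \<longlonglongrightarrow> \<bar>measure_pmf.expectation (law_at P \<pi> t) real - measure_pmf.expectation \<nu> real\<bar>"
    unfolding E_def by (intro tendsto_intros lim int_law int_\<nu>)
  then show "\<bar>measure_pmf.expectation (law_at P \<pi> t) real - measure_pmf.expectation \<nu> real\<bar> \<le> R"
    by (rule LIMSEQ_le_const2) (use bound in blast)
qed

end

section \<open>The M/M/n queue\<close>

lemma
  fixes f :: "nat \<Rightarrow> real"
  assumes "\<And>x. 0 \<le> f x" "summable (\<lambda>x. pmf p x * f x)"
  shows integrable_nat_pmf: "integrable (measure_pmf p) f"
    and expectation_nat_pmf: "measure_pmf.expectation p f = (\<Sum>x. pmf p x * f x)"
proof -
  have "integrable (count_space UNIV) (\<lambda>x. pmf p x * f x)"
    using assms by (simp add: integrable_count_space_nat_iff)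
  then show "integrable (measure_pmf p) f" "measure_pmf.expectation p f = (\<Sum>x. pmf p x * f x)"
    unfolding measure_pmf_eq_density
    by (simp_all add: integrable_density integral_density integral_count_space_nat)
qed

lemma sum_lessThan_add:
  fixes h :: "nat \<Rightarrow> 'a :: comm_monoid_add"
  shows "(\<Sum>x<n + m. h x) = (\<Sum>x<n. h x) + (\<Sum>k<m. h (n + k))"
  by (induction m) (auto simp: add.assoc)

text \<open>Two summations by parts lower the degree of the weights
  \<open>(k + 1) * (k + 2)\<close>, which dominate \<open>k^2\<close>; each costs a factor
  \<open>1 / (1 - \<rho>)\<close> and leaves a boundary term of the right sign. Partial sums are
  compared so that the estimate can precede summability.\<close>

lemma geometric_second_moment_le:
  fixes \<rho> :: real
  assumes "0 \<le> \<rho>" "\<rho> < 1"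
  shows "(\<Sum>k<m. \<rho> ^ k * (real k)\<^sup>2) \<le> 2 / (1 - \<rho>)\<^sup>2 * (\<Sum>k<m. \<rho> ^ k)"
proof -
  have 1: "(1 - \<rho>) * (\<Sum>k<m. \<rho> ^ k * (real k + 1)) = (\<Sum>k<m. \<rho> ^ k) - real m * \<rho> ^ m"
  proof (induction m)
    case (Suc m)
    show ?case unfolding sum.lessThan_Suc distrib_left[of "1 - \<rho>"] Suc by (simp add: algebra_simps)
  qed simp
  have 2: "(1 - \<rho>) * (\<Sum>k<m. \<rho> ^ k * ((real k + 1) * (real k + 2)))
      = 2 * (\<Sum>k<m. \<rho> ^ k * (real k + 1)) - real m * (real m + 1) * \<rho> ^ m"
  proof (induction m)
    case (Suc m)
    show ?case
      unfolding sum.lessThan_Suc distrib_left[of "1 - \<rho>"] distrib_left[of 2] Suc by (simp add: algebra_simps)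
  qed simp
  have "(1 - \<rho>)\<^sup>2 * (\<Sum>k<m. \<rho> ^ k * (real k)\<^sup>2)
      \<le> (1 - \<rho>)\<^sup>2 * (\<Sum>k<m. \<rho> ^ k * ((real k + 1) * (real k + 2)))"
    using assms by (intro mult_left_mono sum_mono zero_le_power2) (auto simp: power2_eq_square algebra_simps)
  also have "\<dots> = (1 - \<rho>) * (2 * (\<Sum>k<m. \<rho> ^ k * (real k + 1)) - real m * (real m + 1) * \<rho> ^ m)"
    by (simp only: power2_eq_square mult.assoc 2)
  also have "\<dots> \<le> 2 * ((1 - \<rho>) * (\<Sum>k<m. \<rho> ^ k * (real k + 1)))"
    using assms mult_nonneg_nonneg[of "1 - \<rho>" "real m * (real m + 1) * \<rho> ^ m"]
    by (simp add: right_diff_distrib[of "1 - \<rho>"])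
  also have "\<dots> \<le> 2 * (\<Sum>k<m. \<rho> ^ k)" unfolding 1 using assms by simp
  finally show ?thesis using assms by (simp add: field_simps)
qed

lemma
  fixes n :: nat and lam :: real
  assumes "0 < lam" "1 \<le> n" and chain: "markov_chain (mmn_rates n lam) P" and "stationary P \<nu>"
  shows mmn_stationary_birth_death_chain:
    "stationary_birth_death_chain (\<lambda>_. lam) (\<lambda>q. real (min n q)) (lam + real n) P \<nu>"
    and mmn_stationary_tail: "pmf \<nu> (n + k) = pmf \<nu> n * (lam / real n) ^ k"
proof -
  show *: "stationary_birth_death_chain (\<lambda>_. lam) (\<lambda>q. real (min n q)) (lam + real n) P \<nu>"
    using assms by unfold_locales (auto simp: mmn_rates_def)
  then interpret stationary_birth_death_chain "\<lambda>_. lam" "\<lambda>q. real (min n q)" "lam + real n" P \<nu> .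
  show "pmf \<nu> (n + k) = pmf \<nu> n * (lam / real n) ^ k"
  proof (induction k)
    case (Suc k)
    have "lam * pmf \<nu> (n + k) = real n * pmf \<nu> (n + Suc k)"
      using detailed_balance[of "n + k"] by simp
    with \<open>1 \<le> n\<close> have "pmf \<nu> (n + Suc k) = pmf \<nu> (n + k) * (lam / real n)"
      by (simp add: field_simps)
    with Suc show ?case by simp
  qed simp
qed

text \<open>Below \<open>n\<close> the integrand is at most \<open>n^2\<close>; above, the law is
  geometric. The two bounds are weighted by masses of total at most 1, hence the maximum and not the
  sum, which part (b) needs for its prefactor \<open>n\<close>.\<close>

lemma mmn_second_moment:
  fixes n :: nat and lam :: real and \<nu> :: "nat pmf"
  assumes "0 < lam" "lam < real n" and tail: "\<And>k. pmf \<nu> (n + k) = pmf \<nu> n * (lam / real n) ^ k"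
  defines "V \<equiv> max ((real n)\<^sup>2) (2 / (1 - lam / real n)\<^sup>2)"
  shows "integrable (measure_pmf \<nu>) (\<lambda>x. (real x - real n)\<^sup>2)"
    and "measure_pmf.expectation \<nu> (\<lambda>x. (real x - real n)\<^sup>2) \<le> V"
proof -
  define h where "h x = pmf \<nu> x * (real x - real n)\<^sup>2" for x
  have h_nonneg: "0 \<le> h x" for x by (simp add: h_def)
  have partial: "(\<Sum>x<N. h x) \<le> V" for N
  proof -
    have "(\<Sum>x<N. h x) \<le> (\<Sum>x<n + N. h x)"
      using h_nonneg by (intro sum_mono2) auto
    also have "\<dots> = (\<Sum>x<n. h x) + (\<Sum>k<N. h (n + k))" by (rule sum_lessThan_add)
    also have "(\<Sum>x<n. h x) \<le> (\<Sum>x<n. pmf \<nu> x * V)"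
      unfolding h_def
    proof (intro sum_mono mult_left_mono)
      fix x assume "x \<in> {..<n}"
      then have "(real n - real x)\<^sup>2 \<le> (real n)\<^sup>2" by (intro power_mono) auto
      then show "(real x - real n)\<^sup>2 \<le> V" by (simp add: V_def power2_commute)
    qed simp
    also have "(\<Sum>k<N. h (n + k)) \<le> (\<Sum>k<N. pmf \<nu> (n + k) * V)"
    proof -
      have "(\<Sum>k<N. h (n + k)) = pmf \<nu> n * (\<Sum>k<N. (lam / real n) ^ k * (real k)\<^sup>2)"
        by (simp add: h_def tail sum_distrib_left mult.assoc)
      also have "\<dots> \<le> pmf \<nu> n * (2 / (1 - lam / real n)\<^sup>2 * (\<Sum>k<N. (lam / real n) ^ k))"
        using assms by (intro mult_left_mono geometric_second_moment_le) auto
      also have "\<dots> \<le> pmf \<nu> n * (V * (\<Sum>k<N. (lam / real n) ^ k))"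
        using assms by (intro mult_left_mono mult_right_mono sum_nonneg) (auto simp: V_def)
      also have "\<dots> = (\<Sum>k<N. pmf \<nu> (n + k) * V)"
        by (simp add: tail sum_distrib_left mult_ac)
      finally show ?thesis .
    qed
    also have "(\<Sum>x<n. pmf \<nu> x * V) + (\<Sum>k<N. pmf \<nu> (n + k) * V) = (\<Sum>x<n + N. pmf \<nu> x) * V"
      by (simp add: sum_lessThan_add sum_distrib_right ring_distribs)
    also have "\<dots> \<le> 1 * V"
      using measure_pmf.prob_le_1[of \<nu> "{..<n + N}"]
      by (intro mult_right_mono) (auto simp: measure_measure_pmf_finite V_def le_max_iff_disj)
    finally show ?thesis by simp
  qed
  have "summable h"
  proof (rule bounded_imp_summable[OF h_nonneg])
    show "(\<Sum>x\<le>N. h x) \<le> V" for N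
      using partial[of "Suc N"] by (simp only: lessThan_Suc_atMost)
  qed
  moreover from this have "(\<Sum>x. h x) \<le> V"
    by (intro suminf_le_const partial)
  ultimately show "integrable (measure_pmf \<nu>) (\<lambda>x. (real x - real n)\<^sup>2)"
    "measure_pmf.expectation \<nu> (\<lambda>x. (real x - real n)\<^sup>2) \<le> V"
    unfolding h_def by (simp_all add: integrable_nat_pmf expectation_nat_pmf)
qed

text \<open>The primitive of \<open>g\<close> again grows at most like \<open>r ^ x\<close>, so its
  square against the tail is dominated by a geometric series of ratio
  \<open>r^2 * lam / n\<close>.\<close>

lemma mmn_integrable_test_function:
  fixes n :: nat and lam :: real and \<nu> :: "nat pmf"
  assumes "0 < lam" "1 \<le> n" and tail: "\<And>k. pmf \<nu> (n + k) = pmf \<nu> n * (lam / real n) ^ k"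
    and r: "1 < r" "r\<^sup>2 * lam < real n"
    and g: "\<And>i. 0 \<le> g i" "\<And>i. g i \<le> A * r ^ i"
  shows "integrable (measure_pmf \<nu>) (\<lambda>x. (\<Sum>k<x. g k)\<^sup>2)"
proof -
  define c where "c = A / (r - 1)"
  have F_le: "(\<Sum>k<x. g k) \<le> c * r ^ x" for x
  proof -
    have "0 \<le> A" using order_trans[OF g[of 0]] by simp
    have "(\<Sum>k<x. g k) \<le> (\<Sum>k<x. A * r ^ k)" by (intro sum_mono g)
    also have "\<dots> = A * ((r ^ x - 1) / (r - 1))"
      using r by (simp add: sum_distrib_left[symmetric] geometric_sum)
    also have "\<dots> \<le> A * (r ^ x / (r - 1))"
      using r \<open>0 \<le> A\<close> by (intro mult_left_mono divide_right_mono) auto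
    finally show ?thesis by (simp add: c_def)
  qed
  have "summable (\<lambda>k. pmf \<nu> (k + n) * (\<Sum>i<k + n. g i)\<^sup>2)"
  proof (rule summable_comparison_test')
    show "summable (\<lambda>k. pmf \<nu> n * (c * r ^ n)\<^sup>2 * (lam / real n * r\<^sup>2) ^ k)"
      using r assms(1,2) by (intro summable_mult summable_geometric) (simp add: field_simps)
    fix k
    have "(\<Sum>i<k + n. g i)\<^sup>2 \<le> (c * r ^ (k + n))\<^sup>2"
      using F_le g(1) by (intro power_mono sum_nonneg) auto
    then have "pmf \<nu> n * (lam / real n) ^ k * (\<Sum>i<k + n. g i)\<^sup>2
        \<le> pmf \<nu> n * (lam / real n) ^ k * (c * r ^ (k + n))\<^sup>2"
      using assms by (intro mult_left_mono) auto
    also have "\<dots> = pmf \<nu> n * (c * r ^ n)\<^sup>2 * (lam / real n * r\<^sup>2) ^ k"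
      by (simp add: power_add power_mult_distrib power_divide power_mult[symmetric] mult_ac)
    finally show "norm (pmf \<nu> (k + n) * (\<Sum>i<k + n. g i)\<^sup>2)
        \<le> pmf \<nu> n * (c * r ^ n)\<^sup>2 * (lam / real n * r\<^sup>2) ^ k"
      using tail[of k] assms(1) by (simp add: add.commute abs_mult)
  qed
  then have "summable (\<lambda>x. pmf \<nu> x * (\<Sum>i<x. g i)\<^sup>2)"
    by (simp only: summable_iff_shift[of "\<lambda>x. pmf \<nu> x * (\<Sum>i<x. g i)\<^sup>2"])
  then show ?thesis by (intro integrable_nat_pmf) auto
qed

section \<open>From test functions to decay rates\<close>

lemma mean_queue_bound_test_function:
  fixes n :: nat and lam :: real
  assumes "0 < lam" "lam < real n" and r: "1 < r" "r\<^sup>2 * lam < real n"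
    and g_ge: "\<And>i. 1 \<le> g i" and g_le: "\<And>i. g i \<le> A * r ^ i" and "0 \<le> \<gamma>"
    and g: "\<And>i. lam * g (Suc i) - (lam + real (min n (Suc i))) * g i + real (min n i) * g (i - 1) \<le> - \<gamma> * g i"
    and K: "sqrt (max ((real n)\<^sup>2) (2 / (1 - lam / real n)\<^sup>2)) \<le> K"
  shows "mean_queue_bound n lam \<gamma> K"
  unfolding mean_queue_bound_def
proof (intro allI impI)
  fix P \<nu> \<pi>0 and t :: real
  assume chain: "markov_chain (mmn_rates n lam) P" "stationary P \<nu>"
    and fin: "chi_sq_finite \<pi>0 \<nu>" and "0 \<le> t"
  have "1 \<le> n" using assms(1,2) by (cases n) auto
  note tail = mmn_stationary_tail[OF \<open>0 < lam\<close> \<open>1 \<le> n\<close> chain]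
  note moment = mmn_second_moment[OF assms(1,2) tail]
  interpret stationary_birth_death_chain "\<lambda>_. lam" "\<lambda>q. real (min n q)" "lam + real n" P \<nu>
    by (rule mmn_stationary_birth_death_chain[OF \<open>0 < lam\<close> \<open>1 \<le> n\<close> chain])
  have int: "integrable (measure_pmf \<nu>) (\<lambda>x. (\<Sum>k<x. g k)\<^sup>2)"
    using g_ge by (intro mmn_integrable_test_function[OF \<open>0 < lam\<close> \<open>1 \<le> n\<close> tail r _ g_le])
      (auto intro: order_trans[OF zero_le_one])
  note decay = mean_decay[OF g_ge \<open>0 \<le> \<gamma>\<close> g int moment(1) \<open>0 \<le> t\<close> fin]
  have "sqrt (measure_pmf.expectation \<nu> (\<lambda>x. (real x - real n)\<^sup>2)) \<le> K"
    using real_sqrt_le_mono[OF moment(2)] K by linarith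
  then have "exp (- \<gamma> * t) * sqrt (measure_pmf.expectation \<nu> (\<lambda>x. (real x - real n)\<^sup>2)) * chi \<pi>0 \<nu>
      \<le> exp (- \<gamma> * t) * K * chi \<pi>0 \<nu>"
    by (intro mult_right_mono mult_left_mono chi_nonneg) auto
  with decay show "integrable (measure_pmf (law_at P \<pi>0 t)) real \<and> integrable (measure_pmf \<nu>) real \<and>
      \<bar>measure_pmf.expectation (law_at P \<pi>0 t) real - measure_pmf.expectation \<nu> real\<bar>
        \<le> exp (- \<gamma> * t) * K * chi \<pi>0 \<nu>"
    by linarith
qed

text \<open>The truncated subtractions make \<open>ramp\<close> constant on \<open>{..m}\<close>, quadratic up to \<open>n - 1\<close> and geometric
  from there on; \<open>m = n - 1\<close> is the case without a ramp.\<close>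

definition ramp :: "nat \<Rightarrow> nat \<Rightarrow> real \<Rightarrow> real \<Rightarrow> nat \<Rightarrow> real" where
  "ramp n m \<beta> r i = (1 + \<beta> * real (min i (n - 1) - m) * real (min i (n - 1) - m - 1) / 2) * r ^ (i - (n - 1))"

text \<open>The recursion of the triangular numbers, which truncation extends by zeros below
  \<open>m\<close>. It gives the ramp its linear increments
  \<open>\<beta> * real (i - m)\<close>.\<close>

lemma triangular_increment:
  "real (Suc i - m) * real (Suc i - m - 1) = real (i - m) * real (i - m - 1) + 2 * real (i - m)"
  by (cases "m \<le> i") (auto simp: Suc_diff_le of_nat_diff algebra_simps, cases "i - m", auto simp: algebra_simps)

text \<open>Each type of edge has its own hypothesis: \<open>\<beta> * n \<le> 1 - \<gamma>\<close>
  for the edges of the ramp, the knee inequality for the edge \<open>n - 1\<close>, and the upper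
  bound on \<open>\<gamma>\<close> for the edges above, where the characteristic polynomial factors
  as \<open>- (r - 1) * (n - lam * r)\<close>.\<close>

lemma mean_queue_bound_ramp:
  fixes n m :: nat and lam \<beta> r \<gamma> :: real
  assumes "0 < lam" "lam < real n" and r: "1 < r" "r\<^sup>2 * lam < real n"
    and "m < n" "0 \<le> \<beta>" and \<beta>: "\<beta> = 0 \<or> lam \<le> real m"
    and "0 \<le> \<gamma>" and \<gamma>: "\<gamma> \<le> (r - 1) * (real n / r - lam)" and \<beta>\<gamma>: "\<beta> * real n \<le> 1 - \<gamma>"
    and knee: "lam * (r - 1) * ramp n m \<beta> r (n - 1)
      \<le> (real n - 1) * \<beta> * real (n - 1 - m - 1) + (1 - \<gamma>) * ramp n m \<beta> r (n - 1)"
    and K: "sqrt (max ((real n)\<^sup>2) (2 / (1 - lam / real n)\<^sup>2)) \<le> K"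
  shows "mean_queue_bound n lam \<gamma> K"
proof -
  define g where "g = ramp n m \<beta> r"
  define G where "G = g (n - 1)"
  have g_ge: "1 \<le> g i" for i
  proof -
    have "1 * 1 \<le> g i" unfolding g_def ramp_def
      using \<open>0 \<le> \<beta>\<close> r by (intro mult_mono one_le_power) auto
    then show ?thesis by simp
  qed
  have g_le: "g i \<le> G * r ^ i" for i
  proof -
    have "g i \<le> G * r ^ (i - (n - 1))"
      unfolding G_def g_def ramp_def
      using \<open>0 \<le> \<beta>\<close> r by (intro mult_right_mono add_left_mono divide_right_mono) (auto intro!: mult_mono)
    also have "\<dots> \<le> G * r ^ i"
      using r g_ge[of "n - 1"] by (intro mult_left_mono power_increasing) (auto simp: G_def)
    finally show ?thesis .
  qed
  have step: "g (Suc i) = g i + \<beta> * real (i - m)" if "Suc i < n" for i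
  proof -
    have "min (Suc i) (n - 1) = Suc i" "min i (n - 1) = i" "Suc i - (n - 1) = 0" "i - (n - 1) = 0"
      using that by auto
    then show ?thesis
      unfolding g_def ramp_def using triangular_increment[of i m] by (simp only: mult.assoc) (simp add: field_simps)
  qed
  have "0 \<le> 1 - \<gamma>" using \<beta>\<gamma> \<open>0 \<le> \<beta>\<close> by (meson mult_nonneg_nonneg of_nat_0_le_iff order_trans)
  have main: "lam * g (Suc i) - (lam + real (min n (Suc i))) * g i + real (min n i) * g (i - 1) \<le> - \<gamma> * g i" for i
  proof -
    consider (below) "Suc i < n" | (corner) "Suc i = n" | (above) "n \<le> i" by linarith
    then show ?thesis
    proof cases
      case below
      have prev: "real i * g (i - 1) = real i * g i - real i * (\<beta> * real (i - 1 - m))"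
        using step[of "i - 1"] below by (cases i) (auto simp: algebra_simps)
      have "\<beta> * (lam * real (i - m) - real i * real (i - 1 - m)) \<le> (1 - \<gamma>) * g i"
      proof (cases "\<beta> = 0 \<or> i \<le> m")
        case True
        moreover have "0 \<le> (1 - \<gamma>) * g i"
          using \<open>0 \<le> 1 - \<gamma>\<close> g_ge[of i] by (intro mult_nonneg_nonneg) auto
        ultimately show ?thesis by auto
      next
        case False
        with \<beta> have "lam \<le> real m" "m < i" by auto
        \<comment> \<open>As \<open>lam \<le> m < i\<close>, the death term cancels the birth term
          up to the shift by one in the increment, and this shift costs at most
          \<open>i\<close>.\<close>
        then have "lam * real (i - m) \<le> real i * real (i - m)" by (intro mult_right_mono) auto
        then have "lam * real (i - m) - real i * real (i - 1 - m) \<le> real i"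
          using \<open>m < i\<close> by (simp add: of_nat_diff algebra_simps)
        then have "\<beta> * (lam * real (i - m) - real i * real (i - 1 - m)) \<le> \<beta> * real n"
          using \<open>0 \<le> \<beta>\<close> below by (intro mult_left_mono) auto
        also note \<beta>\<gamma>
        also have "1 - \<gamma> \<le> (1 - \<gamma>) * g i"
          using \<open>0 \<le> 1 - \<gamma>\<close> g_ge[of i] mult_left_mono[of 1 "g i" "1 - \<gamma>"] by simp
        finally show ?thesis .
      qed
      then show ?thesis using below prev by (simp add: step algebra_simps)
    next
      case corner
      then have n1: "n - 1 = i" "min n i = i" "min n (Suc i) = n" by auto
      \<comment> \<open>From \<open>n - 1\<close> on the polynomial factor is frozen and only the
        power advances.\<close>
      have up: "g (Suc i) = r * g i"
        using corner by (auto simp: g_def ramp_def)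
      have prev: "real i * g (i - 1) = real i * g i - real i * (\<beta> * real (i - 1 - m))"
        using step[of "i - 1"] corner by (cases i) (auto simp: algebra_simps)
      have "real n - 1 = real i" "n - 1 - m - 1 = i - 1 - m" using corner by auto
      then have "lam * (r - 1) * g i \<le> real i * \<beta> * real (i - 1 - m) + (1 - \<gamma>) * g i"
        using knee by (simp only: n1 g_def)
      moreover have "real n = real i + 1" using corner by simp
      ultimately show ?thesis unfolding n1 up prev by (simp add: algebra_simps)
    next
      case above
      define j where "j = i - n"
      have i: "i = n + j" using above by (simp add: j_def)
      have "Suc i - (n - 1) = Suc (Suc j)" "i - (n - 1) = Suc j" "i - 1 - (n - 1) = j"
        "min (Suc i) (n - 1) = n - 1" "min i (n - 1) = n - 1" "min (i - 1) (n - 1) = n - 1"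
        using i \<open>m < n\<close> by auto
      then have vals: "g (Suc i) = G * r ^ j * (r * r)" "g i = G * r ^ j * r" "g (i - 1) = G * r ^ j"
        unfolding g_def G_def ramp_def by simp_all
      have "\<gamma> * r \<le> (r - 1) * (real n / r - lam) * r"
        using \<gamma> r by (intro mult_right_mono) auto
      also have "\<dots> = (r - 1) * (real n - lam * r)" using r by (simp add: field_simps)
      finally have "lam * (r * r) - (lam + real n) * r + real n \<le> - \<gamma> * r"
        by (simp add: algebra_simps)
      then have "G * r ^ j * (lam * (r * r) - (lam + real n) * r + real n) \<le> G * r ^ j * (- \<gamma> * r)"
        using r g_ge[of "n - 1"] by (intro mult_left_mono) (auto simp: G_def)
      moreover have "min n (Suc i) = n" "min n i = n" using above by auto
      ultimately show ?thesis unfolding vals by (simp add: algebra_simps)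
    qed
  qed
  show ?thesis
    by (rule mean_queue_bound_test_function[OF assms(1,2) r g_ge g_le \<open>0 \<le> \<gamma>\<close> main K])
qed

lemma ramp_corner:
  "ramp n m \<beta> r (n - 1) = 1 + \<beta> * real (n - 1 - m) * real (n - 1 - m - 1) / 2"
  by (simp add: ramp_def)

text \<open>Without a ramp the edge \<open>n - 1\<close> has only the unit gain to set against the
  kink, whence \<open>\<gamma> \<le> 1 - lam * (r - 1)\<close>.\<close>

lemma mean_queue_bound_kink:
  fixes n :: nat and lam r \<gamma> :: real
  assumes "0 < lam" "lam < real n" "1 < r" "r\<^sup>2 * lam < real n"
    and "0 \<le> \<gamma>" "\<gamma> \<le> (r - 1) * (real n / r - lam)" "\<gamma> \<le> 1 - lam * (r - 1)"
    and K: "sqrt (max ((real n)\<^sup>2) (2 / (1 - lam / real n)\<^sup>2)) \<le> K"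
  shows "mean_queue_bound n lam \<gamma> K"
proof (rule mean_queue_bound_ramp[where m = "n - 1" and \<beta> = 0 and r = r])
  have "0 \<le> lam * (r - 1)" using assms by simp
  then show "0 * real n \<le> 1 - \<gamma>" using assms by linarith
  show "n - 1 < n" using assms by (cases n) auto
qed (use assms in \<open>auto simp: ramp_def\<close>)

text \<open>A ratio slightly above 1 satisfies all constraints strictly. This serves the small
  \<open>n\<close>, to which the asymptotic choices do not apply.\<close>

lemma mean_queue_bound_positive_rate:
  fixes n :: nat and lam :: real
  assumes "0 < lam" "lam < real n"
    and K: "sqrt (max ((real n)\<^sup>2) (2 / (1 - lam / real n)\<^sup>2)) \<le> K"
  obtains \<gamma> where "0 < \<gamma>" "mean_queue_bound n lam \<gamma> K"
proof -
  have "((\<lambda>r. r\<^sup>2 * lam) \<longlongrightarrow> 1\<^sup>2 * lam) (at_right 1)" "((\<lambda>r. lam * (r - 1)) \<longlongrightarrow> lam * (1 - 1)) (at_right 1)"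
    by (intro tendsto_intros)+
  then have "\<forall>\<^sub>F r in at_right 1. r\<^sup>2 * lam < real n" "\<forall>\<^sub>F r in at_right 1. lam * (r - 1) < 1"
    using assms by (auto intro: order_tendstoD(2))
  then have "\<forall>\<^sub>F r in at_right (1 :: real). 1 < r \<and> r\<^sup>2 * lam < real n \<and> lam * (r - 1) < 1"
    using eventually_at_right_less[of 1] by eventually_elim simp
  then obtain r where r: "1 < r" "r\<^sup>2 * lam < real n" "lam * (r - 1) < 1"
    using eventually_happens'[OF trivial_limit_at_right_real] by blast
  have "r * lam \<le> r * (r * lam)" using r assms mult_right_mono[of 1 r "r * lam"] by simp
  with r(2) have "r * lam < real n" by (simp add: power2_eq_square mult.assoc)
  then have "lam < real n / r" using r(1) by (simp add: field_simps)
  then have pos: "0 < (r - 1) * (real n / r - lam)" using r(1) by (intro mult_pos_pos) auto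
  show ?thesis
  proof
    show "0 < min ((r - 1) * (real n / r - lam)) (1 - lam * (r - 1))" using pos r by simp
    then show "mean_queue_bound n lam (min ((r - 1) * (real n / r - lam)) (1 - lam * (r - 1))) K"
      by (intro mean_queue_bound_kink[OF assms(1,2) r(1,2)] K) auto
  qed
qed

lemma mean_queue_bound_limit:
  assumes bound: "\<forall>\<^sub>F r in F. mean_queue_bound n lam (h r) K"
    and lim: "(h \<longlongrightarrow> \<gamma>) F" and "F \<noteq> bot"
  shows "mean_queue_bound n lam \<gamma> K"
  unfolding mean_queue_bound_def
proof (intro allI impI)
  fix P \<nu> \<pi>0 and t :: real
  assume *: "markov_chain (mmn_rates n lam) P" "stationary P \<nu>" "chi_sq_finite \<pi>0 \<nu>" "t \<ge> 0"
  let ?D = "\<bar>measure_pmf.expectation (law_at P \<pi>0 t) real - measure_pmf.expectation \<nu> real\<bar>"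
  have ev: "\<forall>\<^sub>F r in F. integrable (measure_pmf (law_at P \<pi>0 t)) real \<and> integrable (measure_pmf \<nu>) real \<and>
      ?D \<le> exp (- h r * t) * K * chi \<pi>0 \<nu>"
    using bound * by (auto simp: mean_queue_bound_def elim!: eventually_mono)
  then have "integrable (measure_pmf (law_at P \<pi>0 t)) real \<and> integrable (measure_pmf \<nu>) real"
    using eventually_happens'[OF \<open>F \<noteq> bot\<close>] by blast
  moreover have "?D \<le> exp (- \<gamma> * t) * K * chi \<pi>0 \<nu>"
  proof (rule tendsto_lowerbound[OF _ _ \<open>F \<noteq> bot\<close>])
    show "((\<lambda>r. exp (- h r * t) * K * chi \<pi>0 \<nu>) \<longlongrightarrow> exp (- \<gamma> * t) * K * chi \<pi>0 \<nu>) F"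
      by (intro tendsto_intros lim)
    show "\<forall>\<^sub>F r in F. ?D \<le> exp (- h r * t) * K * chi \<pi>0 \<nu>"
      using ev by eventually_elim simp
  qed
  ultimately show "integrable (measure_pmf (law_at P \<pi>0 t)) real \<and> integrable (measure_pmf \<nu>) real \<and>
      ?D \<le> exp (- \<gamma> * t) * K * chi \<pi>0 \<nu>" by blast
qed

text \<open>The ratio \<open>\<rho> = sqrt (n / lam)\<close> is optimal above \<open>n\<close> but makes the test function just fail to be
  square integrable, so the rate is reached as a limit of ratios \<open>r < \<rho>\<close>.\<close>

lemma mean_queue_bound_critical:
  fixes n m :: nat and lam \<beta> :: real
  assumes "0 < lam" "lam < real n" "m < n" "0 \<le> \<beta>" and \<beta>: "\<beta> = 0 \<or> lam \<le> real m"
  defines "\<gamma> \<equiv> (sqrt (real n) - sqrt lam)\<^sup>2" and "k \<equiv> n - 1 - m"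
  assumes \<beta>\<gamma>: "\<beta> * real n \<le> 1 - \<gamma>"
    and corner: "(real n - lam) / 2 * (1 + \<beta> * real k * real (k - 1) / 2)
      \<le> (real n - 1) * \<beta> * real (k - 1) + (1 - \<gamma>) * (1 + \<beta> * real k * real (k - 1) / 2)"
    and K: "sqrt (max ((real n)\<^sup>2) (2 / (1 - lam / real n)\<^sup>2)) \<le> K"
  shows "mean_queue_bound n lam \<gamma> K"
proof -
  define \<rho> where "\<rho> = sqrt (real n) / sqrt lam"
  define h where "h r = (r - 1) * (real n / r - lam)" for r
  define a b where "a = sqrt (real n)" and "b = sqrt lam"
  have ab: "0 < b" "b < a" "real n = a * a" "lam = b * b" "\<rho> = a / b" "\<gamma> = (a - b)\<^sup>2"
    using assms(1,2) by (auto simp: a_def b_def \<rho>_def \<gamma>_def)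
  have "1 < \<rho>" using ab by simp
  have "h \<rho> = \<gamma>"
    unfolding h_def ab(3-6) using ab(1,2) by (simp add: field_simps power2_eq_square)
  have "(h \<longlongrightarrow> h \<rho>) (at_left \<rho>)"
    unfolding h_def using \<open>1 < \<rho>\<close> by (intro tendsto_intros) auto
  then have lim: "(h \<longlongrightarrow> \<gamma>) (at_left \<rho>)" by (simp add: \<open>h \<rho> = \<gamma>\<close>)
  have bound: "mean_queue_bound n lam (h r) K" if r: "1 < r" "r < \<rho>" for r
  proof -
    have "r * b < a" using r ab by (simp add: field_simps)
    then have "(r * b)\<^sup>2 < a\<^sup>2" using r ab by (intro power_strict_mono) auto
    then have r2: "r\<^sup>2 * lam < real n" using ab by (simp add: power2_eq_square mult_ac)
    have "r * lam \<le> r\<^sup>2 * lam" using r assms(1) by (intro mult_right_mono) (auto simp: power2_eq_square)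
    with r2 have "r * lam < real n" by simp
    then have "lam \<le> real n / r" using r(1) by (simp add: field_simps)
    then have "0 \<le> h r" using r by (simp add: h_def)
    \<comment> \<open>The shortfall of the rate at \<open>r\<close> is nonnegative, so the
      hypotheses stated with \<open>\<gamma>\<close> cover every \<open>h r\<close>.\<close>
    have "\<gamma> - h r = (a - r * b)\<^sup>2 / r"
      unfolding h_def ab(3,4,6) using r by (simp add: field_simps power2_eq_square)
    then have "h r \<le> \<gamma>" using r by (smt (verit) divide_nonneg_pos zero_le_power2)
    define G where "G = 1 + \<beta> * real k * real (k - 1) / 2"
    have "1 \<le> G" using \<open>0 \<le> \<beta>\<close> by (simp add: G_def)
    \<comment> \<open>At \<open>\<rho>\<close> the kink costs \<open>a * b - b * b\<close>, at most
      \<open>(a * a - b * b) / 2\<close>; hence \<open>(n - lam) / 2\<close> in the corner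
      hypothesis.\<close>
    have "lam * (r - 1) \<le> lam * (\<rho> - 1)" using r assms(1) by (intro mult_left_mono) auto
    also have "\<dots> = a * b - b * b" using ab by (simp add: field_simps)
    also have "\<dots> \<le> (real n - lam) / 2"
      using zero_le_power2[of "a - b"] ab by (simp add: power2_eq_square algebra_simps)
    finally have "lam * (r - 1) * G \<le> (real n - lam) / 2 * G"
      using \<open>1 \<le> G\<close> by (intro mult_right_mono) auto
    also have "\<dots> \<le> (real n - 1) * \<beta> * real (k - 1) + (1 - \<gamma>) * G" using corner by (simp add: G_def)
    also have "\<dots> \<le> (real n - 1) * \<beta> * real (k - 1) + (1 - h r) * G"
      using \<open>1 \<le> G\<close> \<open>h r \<le> \<gamma>\<close> by (intro add_left_mono mult_right_mono) auto
    finally have "lam * (r - 1) * ramp n m \<beta> r (n - 1)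
        \<le> (real n - 1) * \<beta> * real (n - 1 - m - 1) + (1 - h r) * ramp n m \<beta> r (n - 1)"
      by (simp only: ramp_corner G_def k_def)
    then show ?thesis
      using \<beta>\<gamma> \<open>h r \<le> \<gamma>\<close>
      by (intro mean_queue_bound_ramp[OF assms(1,2) r(1) r2 assms(3,4) \<beta> \<open>0 \<le> h r\<close> _ _ _ K])
        (auto simp: h_def)
  qed
  have "\<forall>\<^sub>F r in at_left \<rho>. 1 < r \<and> r < \<rho>"
    using \<open>1 < \<rho>\<close> eventually_at_leftI[of 1 \<rho>] by force
  then have "\<forall>\<^sub>F r in at_left \<rho>. mean_queue_bound n lam (h r) K"
    by eventually_elim (use bound in blast)
  then show ?thesis by (rule mean_queue_bound_limit[OF _ lim]) simp
qed

section \<open>The three regimes of part (a)\<close>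

text \<open>For \<open>lam = n - n powr (1 - \<alpha>)\<close> this bounds the critical rate by
  \<open>n powr (1 - 2 * \<alpha>)\<close>, which tends to 0 when
  \<open>\<alpha> > 1/2\<close>.\<close>

lemma sqrt_gap_squared_le:
  assumes "0 \<le> lam" "lam \<le> x" "0 < x"
  shows "(sqrt x - sqrt lam)\<^sup>2 \<le> (x - lam)\<^sup>2 / x"
proof -
  have "x - lam = (sqrt x - sqrt lam) * (sqrt x + sqrt lam)"
    using assms by (simp add: algebra_simps)
  then have "(x - lam)\<^sup>2 = (sqrt x - sqrt lam)\<^sup>2 * (sqrt x + sqrt lam)\<^sup>2"
    by (simp add: power_mult_distrib)
  moreover have "(sqrt x)\<^sup>2 \<le> (sqrt x + sqrt lam)\<^sup>2"
    using assms by (intro power_mono) auto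
  then have "(sqrt x - sqrt lam)\<^sup>2 * x \<le> (sqrt x - sqrt lam)\<^sup>2 * (sqrt x + sqrt lam)\<^sup>2"
    using assms by (intro mult_left_mono) auto
  ultimately show ?thesis using assms by (simp add: field_simps)
qed

text \<open>The case \<open>\<alpha> \<ge> 1\<close>. The kink costs at most
  \<open>\<delta> / 2 \<le> 1 / 2\<close> and the critical rate is at most
  \<open>\<delta>^2 / n \<le> 1 / 2\<close>, so the unit gain covers both.\<close>

lemma mean_queue_bound_super_halfin_whitt:
  fixes n :: nat and \<delta> :: real
  assumes "0 < \<delta>" "\<delta> \<le> 1" "2 \<le> n"
    and K: "sqrt (max ((real n)\<^sup>2) (2 / (1 - (real n - \<delta>) / real n)\<^sup>2)) \<le> K"
  shows "mean_queue_bound n (real n - \<delta>) ((sqrt (real n) - sqrt (real n - \<delta>))\<^sup>2) K"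
proof -
  have "(sqrt (real n) - sqrt (real n - \<delta>))\<^sup>2 \<le> \<delta>\<^sup>2 / real n"
    using sqrt_gap_squared_le[of "real n - \<delta>" "real n"] assms by simp
  also have "\<dots> \<le> 1\<^sup>2 / 2" using assms by (intro frac_le power_mono) auto
  finally have "(sqrt (real n) - sqrt (real n - \<delta>))\<^sup>2 \<le> 1 / 2" by simp
  then show ?thesis
    using assms by (intro mean_queue_bound_critical[where m = "n - 1" and \<beta> = 0]) auto
qed

text \<open>The case \<open>1/2 < \<alpha> < 1\<close> for large \<open>n\<close>. The ramp starts
  about \<open>\<delta>\<close> states below \<open>n\<close> with the largest curvature allowed and
  earns at least \<open>3 / 4 * (\<delta> - 3)\<close> at the corner, against a critical kink of
  cost \<open>\<delta> / 2\<close>. As \<open>\<delta>^2 / n\<close> is small, the height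
  \<open>G\<close> stays near 1 and hardly raises that cost.\<close>

lemma mean_queue_bound_moderate:
  fixes n :: nat and \<delta> :: real
  assumes "16 \<le> \<delta>" "\<delta>\<^sup>2 \<le> real n / 8"
    and K: "sqrt (max ((real n)\<^sup>2) (2 / (1 - (real n - \<delta>) / real n)\<^sup>2)) \<le> K"
  shows "mean_queue_bound n (real n - \<delta>) ((sqrt (real n) - sqrt (real n - \<delta>))\<^sup>2) K"
proof -
  define \<gamma> where "\<gamma> = (sqrt (real n) - sqrt (real n - \<delta>))\<^sup>2"
  have "\<delta> * 16 \<le> \<delta> * \<delta>" using assms(1) by (intro mult_left_mono) auto
  then have n: "\<delta> * 128 \<le> real n" using assms(2) by (simp add: power2_eq_square)
  have "\<gamma> \<le> \<delta>\<^sup>2 / real n"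
    unfolding \<gamma>_def using sqrt_gap_squared_le[of "real n - \<delta>" "real n"] n assms(1) by simp
  also have "\<dots> \<le> 1 / 8" using assms n by (simp add: field_simps)
  finally have "\<gamma> \<le> 1 / 8" .
  \<comment> \<open>Rounding \<open>\<delta>\<close> down keeps \<open>m\<close> at or above
    \<open>lam\<close>.\<close>
  define m where "m = n - nat \<lfloor>\<delta>\<rfloor>"
  define k where "k = n - 1 - m"
  define \<beta> where "\<beta> = (1 - \<gamma>) / real n"
  have fl: "real (nat \<lfloor>\<delta>\<rfloor>) \<le> \<delta>" "\<delta> - 1 < real (nat \<lfloor>\<delta>\<rfloor>)"
    using assms(1) by linarith+
  then have "nat \<lfloor>\<delta>\<rfloor> < n" "0 < nat \<lfloor>\<delta>\<rfloor>" using n assms(1) by linarith+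
  then have m: "m < n" "real m = real n - real (nat \<lfloor>\<delta>\<rfloor>)" and k_eq: "Suc k = nat \<lfloor>\<delta>\<rfloor>"
    by (auto simp: m_def k_def of_nat_diff)
  then have k: "real k \<le> \<delta> - 1" "\<delta> - 3 \<le> real (k - 1)" "real (k - 1) \<le> \<delta>"
    using fl by linarith+
  have \<beta>: "0 \<le> \<beta>" "\<beta> \<le> 1 / real n" "\<beta> * real n = 1 - \<gamma>"
    using \<open>\<gamma> \<le> 1 / 8\<close> n assms(1) by (auto simp: \<beta>_def \<gamma>_def divide_right_mono)
  define G where "G = 1 + \<beta> * real k * real (k - 1) / 2"
  have "1 \<le> G" using \<beta> by (simp add: G_def)
  have "\<beta> * real k * real (k - 1) \<le> 1 / real n * \<delta> * \<delta>"
    using \<beta> k assms(1) by (intro mult_mono) auto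
  also have "\<dots> \<le> 1 / 8" using assms(2) n assms(1) by (simp add: field_simps power2_eq_square)
  finally have "G \<le> 17 / 16" by (simp add: G_def)
  then have "\<delta> / 2 * G \<le> \<delta> / 2 * (17 / 16)" using assms(1) by (intro mult_left_mono) auto
  \<comment> \<open>The margin between \<open>17 / 32\<close> and \<open>3 / 4\<close> absorbs the
    rounding loss 3 once \<open>\<delta> \<ge> 16\<close>.\<close>
  also have "\<dots> \<le> 3 / 4 * (\<delta> - 3)" using assms(1) by simp
  also have "\<dots> \<le> (real n - 1) * \<beta> * real (k - 1)"
  proof (intro mult_mono k)
    have "\<beta> * 8 \<le> \<beta> * real n" using n assms(1) \<beta>(1) by (intro mult_left_mono) auto
    then have "3 / 4 \<le> \<beta> * real n - \<beta>" using \<beta>(3) \<open>\<gamma> \<le> 1 / 8\<close> by linarith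
    then show "3 / 4 \<le> (real n - 1) * \<beta>" by (simp add: algebra_simps)
  qed (use assms(1) n \<beta>(1) in auto)
  also have "\<dots> \<le> (real n - 1) * \<beta> * real (k - 1) + (1 - \<gamma>) * G"
    using \<open>1 \<le> G\<close> \<open>\<gamma> \<le> 1 / 8\<close> by simp
  finally have "\<delta> / 2 * G \<le> (real n - 1) * \<beta> * real (k - 1) + (1 - \<gamma>) * G" .
  then have corner: "(real n - (real n - \<delta>)) / 2 * (1 + \<beta> * real k * real (k - 1) / 2)
      \<le> (real n - 1) * \<beta> * real (k - 1) + (1 - \<gamma>) * (1 + \<beta> * real k * real (k - 1) / 2)"
    by (simp add: G_def)
  show ?thesis
  proof (rule mean_queue_bound_critical[OF _ _ m(1) \<beta>(1) _ _ corner[unfolded \<gamma>_def k_def] K])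
    show "\<beta> = 0 \<or> real n - \<delta> \<le> real m" using m fl by simp
    show "\<beta> * real n \<le> 1 - (sqrt (real n) - sqrt (real n - \<delta>))\<^sup>2"
      using \<beta>(3) by (simp add: \<gamma>_def)
  qed (use assms(1) n in auto)
qed

text \<open>The case \<open>\<alpha> < 1/2\<close> for large \<open>n\<close>. Now
  \<open>\<delta>^2 / n\<close> is not small and the height \<open>G\<close> may be large, so the
  ratio must be gentler: with \<open>r - 1 = 1 / (2 * \<delta>)\<close> the cost
  \<open>lam * (r - 1) * G\<close> is at most
  \<open>n / (2 * \<delta>) + \<delta> / 4 \<le> \<delta> / 2\<close>, below the
  \<open>9 / 10 * (\<delta> - 3)\<close> that the ramp earns.\<close>

lemma mean_queue_bound_light:
  fixes n :: nat and \<delta> :: real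
  assumes "16 \<le> \<delta>" "\<delta> < real n" "2 * real n \<le> \<delta>\<^sup>2"
    and K: "sqrt (max ((real n)\<^sup>2) (2 / (1 - (real n - \<delta>) / real n)\<^sup>2)) \<le> K"
  shows "mean_queue_bound n (real n - \<delta>) (1 / 25) K"
proof -
  define lam where "lam = real n - \<delta>"
  define r where "r = 1 + 1 / (2 * \<delta>)"
  define m where "m = n - nat \<lfloor>\<delta>\<rfloor>"
  define k where "k = n - 1 - m"
  \<comment> \<open>The largest curvature compatible with the rate \<open>1 / 25\<close>:
    \<open>\<beta> * n = 1 - 1 / 25\<close>.\<close>
  define \<beta> where "\<beta> = 24 / 25 / real n"
  have n_\<delta>: "real n / \<delta> \<le> \<delta> / 2" using assms by (simp add: field_simps power2_eq_square)
  have lam: "0 < lam" "lam < real n" using assms by (auto simp: lam_def)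
  have r: "1 < r" "r \<le> 33 / 32" using assms(1) by (auto simp: r_def field_simps)
  have lam_r1: "lam * (r - 1) \<le> \<delta> / 4"
  proof -
    have "lam * (r - 1) = lam / \<delta> / 2" by (simp add: r_def)
    also have "\<dots> \<le> real n / \<delta> / 2" using lam assms(1) by (intro divide_right_mono) auto
    also have "\<dots> \<le> \<delta> / 2 / 2" by (intro divide_right_mono n_\<delta>) simp
    finally show ?thesis by simp
  qed
  have r2: "r\<^sup>2 * lam < real n"
  proof -
    have "r\<^sup>2 * lam = lam + (r + 1) * (lam * (r - 1))" by (simp add: power2_eq_square algebra_simps)
    also have "\<dots> \<le> lam + (33 / 32 + 1) * (\<delta> / 4)"
      using r lam lam_r1 assms(1) by (intro add_left_mono mult_mono) auto
    finally show ?thesis using assms(1) by (simp add: lam_def)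
  qed
  have rate: "1 / 25 \<le> (r - 1) * (real n / r - lam)"
  proof -
    have "lam * r = lam + lam * (r - 1)" by (simp add: algebra_simps)
    then have "3 / 4 * \<delta> \<le> real n - lam * r" using lam_r1 by (simp add: lam_def)
    then have "3 / 4 * \<delta> / (33 / 32) \<le> (real n - lam * r) / r"
      using r assms(1) by (intro frac_le) auto
    then have "1 / (2 * \<delta>) * (3 / 4 * \<delta> / (33 / 32)) \<le> (r - 1) * ((real n - lam * r) / r)"
      using assms(1) by (intro mult_mono) (auto simp: r_def)
    then show ?thesis using r assms(1) by (simp add: diff_divide_distrib)
  qed
  have fl: "real (nat \<lfloor>\<delta>\<rfloor>) \<le> \<delta>" "\<delta> - 1 < real (nat \<lfloor>\<delta>\<rfloor>)"
    using assms(1) by linarith+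
  then have "nat \<lfloor>\<delta>\<rfloor> < n" "0 < nat \<lfloor>\<delta>\<rfloor>" using assms(1,2) by linarith+
  then have m: "m < n" "real m = real n - real (nat \<lfloor>\<delta>\<rfloor>)" and k_eq: "Suc k = nat \<lfloor>\<delta>\<rfloor>"
    by (auto simp: m_def k_def of_nat_diff)
  then have k: "real k \<le> \<delta> - 1" "\<delta> - 3 \<le> real (k - 1)" "real (k - 1) \<le> \<delta>"
    using fl by linarith+
  have \<beta>: "0 \<le> \<beta>" "\<beta> \<le> 1 / real n" "\<beta> * real n = 24 / 25"
    using assms(1,2) by (auto simp: \<beta>_def field_simps)
  define G where "G = 1 + \<beta> * real k * real (k - 1) / 2"
  have "1 \<le> G" using \<beta> by (simp add: G_def)
  have "\<beta> * real k * real (k - 1) \<le> 1 / real n * \<delta> * \<delta>"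
    using \<beta> k assms(1) by (intro mult_mono) auto
  then have "G \<le> 1 + \<delta> * \<delta> / (2 * real n)" by (simp add: G_def)
  then have "lam * (r - 1) * G \<le> real n / (2 * \<delta>) * (1 + \<delta> * \<delta> / (2 * real n))"
    using lam r assms(1) \<open>1 \<le> G\<close> by (intro mult_mono) (auto simp: r_def divide_right_mono)
  also have "\<dots> = real n / \<delta> / 2 + \<delta> / 4" using assms(1,2) by (simp add: field_simps)
  also have "\<dots> \<le> 9 / 10 * (\<delta> - 3)" using n_\<delta> assms(1) by simp
  also have "\<dots> \<le> (real n - 1) * \<beta> * real (k - 1)"
  proof (intro mult_mono k)
    have "\<beta> * 16 \<le> \<beta> * real n" using assms(1,2) \<beta>(1) by (intro mult_left_mono) auto
    then have "9 / 10 \<le> \<beta> * real n - \<beta>" using \<beta>(3) by linarith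
    then show "9 / 10 \<le> (real n - 1) * \<beta>" by (simp add: algebra_simps)
  qed (use assms(1,2) \<beta>(1) in auto)
  also have "\<dots> \<le> (real n - 1) * \<beta> * real (k - 1) + (1 - 1 / 25) * G"
    using \<open>1 \<le> G\<close> by simp
  finally have corner: "lam * (r - 1) * G \<le> (real n - 1) * \<beta> * real (k - 1) + (1 - 1 / 25) * G" .
  have "mean_queue_bound n lam (1 / 25) K"
  proof (rule mean_queue_bound_ramp[OF lam r(1) r2 m(1) \<beta>(1) _ _ rate])
    show "lam * (r - 1) * ramp n m \<beta> r (n - 1)
        \<le> (real n - 1) * \<beta> * real (n - 1 - m - 1) + (1 - 1 / 25) * ramp n m \<beta> r (n - 1)"
      using corner by (simp only: ramp_corner G_def k_def)
    show "\<beta> = 0 \<or> lam \<le> real m" using m fl by (simp add: lam_def)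
    show "sqrt (max ((real n)\<^sup>2) (2 / (1 - lam / real n)\<^sup>2)) \<le> K" using K by (simp add: lam_def)
  qed (use \<beta> in auto)
  then show ?thesis by (simp add: lam_def)
qed

section \<open>Asymptotic rates\<close>

text \<open>Here \<open>1 - lam / n\<close> is \<open>n powr (- \<alpha>)\<close>, so the moment
  bound is the larger of \<open>n^2\<close> and \<open>2 * n powr (2 * \<alpha>)\<close>.\<close>

lemma prefactor_bound:
  fixes n :: nat
  assumes "1 \<le> n"
  shows "sqrt (max ((real n)\<^sup>2) (2 / (1 - (real n - real n powr (1 - \<alpha>)) / real n)\<^sup>2))
    \<le> sqrt 2 * (real n + real n powr \<alpha>)"
proof -
  have "1 - (real n - real n powr (1 - \<alpha>)) / real n = 1 / real n powr \<alpha>"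
    using assms by (simp add: powr_diff field_simps)
  then have "2 / (1 - (real n - real n powr (1 - \<alpha>)) / real n)\<^sup>2 = 2 * (real n powr \<alpha>)\<^sup>2"
    by (simp add: power_divide)
  moreover have "2 * (real n powr \<alpha>)\<^sup>2 \<le> 2 * (real n + real n powr \<alpha>)\<^sup>2"
    by (intro mult_left_mono power_mono) auto
  moreover have "(real n)\<^sup>2 \<le> (real n + real n powr \<alpha>)\<^sup>2"
    by (intro power_mono) auto
  moreover have "0 \<le> (real n + real n powr \<alpha>)\<^sup>2" by simp
  ultimately have "max ((real n)\<^sup>2) (2 / (1 - (real n - real n powr (1 - \<alpha>)) / real n)\<^sup>2)
      \<le> 2 * (real n + real n powr \<alpha>)\<^sup>2" by linarith
  then have "sqrt (max ((real n)\<^sup>2) (2 / (1 - (real n - real n powr (1 - \<alpha>)) / real n)\<^sup>2))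
      \<le> sqrt (2 * (real n + real n powr \<alpha>)\<^sup>2)" by (rule real_sqrt_le_mono)
  then show ?thesis by (simp add: real_sqrt_mult)
qed

lemma filterlim_nat_powr_at_top:
  fixes s :: real
  assumes "0 < s"
  shows "filterlim (\<lambda>n. real n powr s) at_top sequentially"
  using assms by real_asymp

text \<open>A rate is required for every \<open>n \<ge> 2\<close>, but the good one is available
  only eventually. Taking \<open>C\<close> wherever it works and any positive rate elsewhere gives
  an eventually constant sequence.\<close>

lemma eventual_rate_completion:
  fixes C :: real
  assumes pos: "\<And>n. 2 \<le> n \<Longrightarrow> \<exists>\<gamma>>0. Q n \<gamma>" and ev: "\<forall>\<^sub>F n in sequentially. Q n C" and "0 < C"
  obtains R :: "nat \<Rightarrow> real" where "\<forall>n\<ge>2. 0 < R n" "R \<longlonglongrightarrow> C" "\<forall>n\<ge>2. Q n (R n)"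
proof -
  define R where "R n = (if Q n C then C else SOME \<gamma>. 0 < \<gamma> \<and> Q n \<gamma>)" for n
  have "0 < R n \<and> Q n (R n)" if "2 \<le> n" for n
    using someI_ex[OF pos[OF that, unfolded Bex_def]] \<open>0 < C\<close> by (auto simp: R_def)
  moreover have "R \<longlonglongrightarrow> C"
    by (rule tendsto_eventually) (use ev in \<open>auto simp: R_def elim!: eventually_mono\<close>)
  ultimately show ?thesis using that by blast
qed

theorem corollary4:
  shows
    "(\<forall>(\<alpha>::real) (lam :: nat \<Rightarrow> real).
        \<alpha> > 0 \<longrightarrow> (\<forall>n\<ge>2. lam n = real n - real n powr (1 - \<alpha>)) \<longrightarrow>
        (\<alpha> \<ge> 1 \<longrightarrow>
           (\<forall>n\<ge>2. mean_queue_bound n (lam n)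
                     ((sqrt (real n) - sqrt (lam n))\<^sup>2)
                     (sqrt 2 * (real n + real n powr \<alpha>)))) \<and>
        (1/2 < \<alpha> \<and> \<alpha> < 1 \<longrightarrow>
           (\<exists>C :: nat \<Rightarrow> real. (\<forall>n\<ge>2. C n > 0) \<and> C \<longlonglongrightarrow> 1 \<and>
              (\<forall>n\<ge>2. mean_queue_bound n (lam n)
                        (C n * (sqrt (real n) - sqrt (lam n))\<^sup>2)
                        (sqrt 2 * (real n + real n powr \<alpha>))))) \<and>
        (\<alpha> < 1/2 \<longrightarrow>
           (\<exists>D :: nat \<Rightarrow> real. (\<forall>n\<ge>2. D n > 0) \<and> D \<longlonglongrightarrow> 1/25 \<and>
              (\<forall>n\<ge>2. mean_queue_bound n (lam n) (D n)
                        (sqrt 2 * (real n + real n powr \<alpha>)))))) \<and>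
     (\<forall>(lam :: nat \<Rightarrow> real) (c::real).
        (\<forall>n\<ge>1. 0 < lam n \<and> lam n < real n) \<longrightarrow> 0 \<le> c \<longrightarrow> c < 1 \<longrightarrow>
        (\<lambda>n. lam n / real n) \<longlonglongrightarrow> c \<longrightarrow>
        (\<exists>L :: nat \<Rightarrow> real. (\<forall>n\<ge>1. L n > 0) \<and> L \<longlonglongrightarrow> 1 - c \<and>
           (\<forall>\<^sub>F n in sequentially. mean_queue_bound n (lam n) (L n) (real n))))"
proof (intro conjI allI impI)
  fix \<alpha> :: real and lam :: "nat \<Rightarrow> real"
  assume "\<alpha> > 0" and lam: "\<forall>n\<ge>2. lam n = real n - real n powr (1 - \<alpha>)"
  define \<delta> where "\<delta> n = real n powr (1 - \<alpha>)" for n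
  define K where "K n = sqrt 2 * (real n + real n powr \<alpha>)" for n
  have \<delta>: "0 < \<delta> n" "\<delta> n < real n" "lam n = real n - \<delta> n" if "2 \<le> n" for n
    using that lam \<open>\<alpha> > 0\<close> powr_less_mono[of "1 - \<alpha>" 1 "real n"] by (auto simp: \<delta>_def)
  have K: "sqrt (max ((real n)\<^sup>2) (2 / (1 - (real n - \<delta> n) / real n)\<^sup>2)) \<le> K n" if "2 \<le> n" for n
    unfolding \<delta>_def K_def using that by (intro prefactor_bound) auto
  have pos: "\<exists>\<gamma>>0. mean_queue_bound n (lam n) \<gamma> (K n)" if "2 \<le> n" for n
    using mean_queue_bound_positive_rate[OF _ _ K[OF that]] \<delta>[OF that] by (metis diff_gt_0_iff_gt diff_less_eq less_add_same_cancel1)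
  \<comment> \<open>This is where \<open>\<alpha> = 1/2\<close> separates the regimes: the exponent
    decides whether \<open>\<delta>^2\<close> is small or large against \<open>n\<close>.\<close>
  have sq: "(\<delta> n)\<^sup>2 = real n * real n powr (1 - 2 * \<alpha>)" if "2 \<le> n" for n
  proof -
    have "(\<delta> n)\<^sup>2 = real n powr (1 + (1 - 2 * \<alpha>))"
      by (simp add: \<delta>_def power2_eq_square powr_add[symmetric])
    also have "\<dots> = real n powr 1 * real n powr (1 - 2 * \<alpha>)" by (rule powr_add)
    finally show ?thesis by simp
  qed
  have \<delta>_large: "\<forall>\<^sub>F n in sequentially. 16 \<le> \<delta> n" if "\<alpha> < 1"
    using filterlim_nat_powr_at_top[of "1 - \<alpha>"] that by (simp add: filterlim_at_top \<delta>_def)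
  {
    fix n :: nat assume "\<alpha> \<ge> 1" "2 \<le> n"
    have "\<delta> n \<le> real n powr 0" unfolding \<delta>_def using \<open>\<alpha> \<ge> 1\<close> \<open>2 \<le> n\<close> by (intro powr_mono) auto
    then show "mean_queue_bound n (lam n) ((sqrt (real n) - sqrt (lam n))\<^sup>2)
        (sqrt 2 * (real n + real n powr \<alpha>))"
      using mean_queue_bound_super_halfin_whitt[OF _ _ \<open>2 \<le> n\<close> K[OF \<open>2 \<le> n\<close>]] \<delta>[OF \<open>2 \<le> n\<close>] \<open>2 \<le> n\<close>
      by (simp add: K_def)
  next
    assume \<alpha>: "1 / 2 < \<alpha> \<and> \<alpha> < 1"
    \<comment> \<open>Rates are measured in units of the critical one, so it suffices that 1 is
      eventually admissible.\<close>
    define Q where "Q n C \<longleftrightarrow> mean_queue_bound n (lam n) (C * (sqrt (real n) - sqrt (lam n))\<^sup>2) (K n)" for n C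
    have "\<exists>C>0. Q n C" if n: "2 \<le> n" for n
    proof -
      obtain \<gamma> where \<gamma>: "0 < \<gamma>" "mean_queue_bound n (lam n) \<gamma> (K n)" using pos[OF n] by blast
      have "sqrt (lam n) < sqrt (real n)" using \<delta>[OF n] by simp
      then have "0 < (sqrt (real n) - sqrt (lam n))\<^sup>2" by simp
      with \<gamma> show ?thesis
        unfolding Q_def by (intro exI[of _ "\<gamma> / (sqrt (real n) - sqrt (lam n))\<^sup>2"]) simp
    qed
    moreover have "\<forall>\<^sub>F n in sequentially. Q n 1"
    proof -
      have "(\<lambda>n. real n powr (1 - 2 * \<alpha>)) \<longlonglongrightarrow> 0"
        using \<alpha> by (intro tendsto_neg_powr filterlim_real_sequentially) auto
      then have "\<forall>\<^sub>F n in sequentially. real n powr (1 - 2 * \<alpha>) < 1 / 8"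
        by (rule order_tendstoD) simp
      moreover have "\<forall>\<^sub>F n in sequentially. 16 \<le> \<delta> n" using \<delta>_large \<alpha> by simp
      ultimately show ?thesis using eventually_ge_at_top[of 2]
      proof eventually_elim
        case (elim n)
        then have "(\<delta> n)\<^sup>2 \<le> real n / 8" using sq[of n] mult_left_mono[of "real n powr (1 - 2 * \<alpha>)" "1 / 8" "real n"] by simp
        then show ?case
          using mean_queue_bound_moderate[OF _ _ K[of n]] elim \<delta>[of n] \<alpha> by (simp add: Q_def)
      qed
    qed
    ultimately obtain C where "\<forall>n\<ge>2. 0 < C n" "C \<longlonglongrightarrow> 1" "\<forall>n\<ge>2. Q n (C n)"
      using eventual_rate_completion[of Q 1] by auto
    then show "\<exists>C. (\<forall>n\<ge>2. C n > 0) \<and> C \<longlonglongrightarrow> 1 \<and> (\<forall>n\<ge>2. mean_queue_bound n (lam n)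
        (C n * (sqrt (real n) - sqrt (lam n))\<^sup>2) (sqrt 2 * (real n + real n powr \<alpha>)))"
      unfolding Q_def K_def by blast
  next
    assume \<alpha>: "\<alpha> < 1 / 2"
    have "\<forall>\<^sub>F n in sequentially. mean_queue_bound n (lam n) (1 / 25) (K n)"
    proof -
      have "\<forall>\<^sub>F n in sequentially. 2 \<le> real n powr (1 - 2 * \<alpha>)"
        using filterlim_nat_powr_at_top[of "1 - 2 * \<alpha>"] \<alpha> by (simp add: filterlim_at_top)
      moreover have "\<forall>\<^sub>F n in sequentially. 16 \<le> \<delta> n" using \<delta>_large \<alpha> by simp
      ultimately show ?thesis using eventually_ge_at_top[of 2]
      proof eventually_elim
        case (elim n)
        then have "2 * real n \<le> (\<delta> n)\<^sup>2" using sq[of n] by simp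
        then show ?case
          using mean_queue_bound_light[OF _ _ _ K[of n]] elim \<delta>[of n] by simp
      qed
    qed
    then obtain D where "\<forall>n\<ge>2. 0 < D n" "D \<longlonglongrightarrow> 1 / 25" "\<forall>n\<ge>2. mean_queue_bound n (lam n) (D n) (K n)"
      using eventual_rate_completion[of "\<lambda>n C. mean_queue_bound n (lam n) C (K n)" "1 / 25"] pos by auto
    then show "\<exists>D. (\<forall>n\<ge>2. D n > 0) \<and> D \<longlonglongrightarrow> 1 / 25 \<and>
        (\<forall>n\<ge>2. mean_queue_bound n (lam n) (D n) (sqrt 2 * (real n + real n powr \<alpha>)))"
      unfolding K_def by blast
  }
next
  fix lam :: "nat \<Rightarrow> real" and c :: real
  assume lam: "\<forall>n\<ge>1. 0 < lam n \<and> lam n < real n" and c: "0 \<le> c" "c < 1"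
    and lim: "(\<lambda>n. lam n / real n) \<longlonglongrightarrow> c"
  \<comment> \<open>The rates that the ratio \<open>r = 1 + 1 / n\<close> allows at the corner and
    above \<open>n\<close>; both tend to \<open>1 - c\<close>.\<close>
  define \<gamma> where "\<gamma> n = min (1 - lam n / real n) (1 / (1 + 1 / real n) - lam n / real n)" for n
  \<comment> \<open>The default 1 secures positivity for the finitely many \<open>n\<close> with
    \<open>\<gamma> n \<le> 0\<close>; the decay bound is asserted for large
    \<open>n\<close>.\<close>
  define L where "L n = (if 0 < \<gamma> n then \<gamma> n else 1)" for n
  have inv: "(\<lambda>n. 1 / real n) \<longlonglongrightarrow> 0" by real_asymp
  have "\<gamma> \<longlonglongrightarrow> min (1 - c) (1 / (1 + 0) - c)"
    unfolding \<gamma>_def by (intro tendsto_intros lim inv) auto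
  then have \<gamma>_lim: "\<gamma> \<longlonglongrightarrow> 1 - c" by simp
  then have \<gamma>_pos: "\<forall>\<^sub>F n in sequentially. 0 < \<gamma> n"
    using c by (intro order_tendstoD(1)) auto
  then have "\<forall>\<^sub>F n in sequentially. \<gamma> n = L n" by eventually_elim (simp add: L_def)
  then have L_lim: "L \<longlonglongrightarrow> 1 - c" using \<gamma>_lim by (rule Lim_transform_eventually[rotated])
  have "(\<lambda>n. (1 + 1 / real n)\<^sup>2 * (lam n / real n)) \<longlonglongrightarrow> (1 + 0)\<^sup>2 * c"
    by (intro tendsto_intros lim inv)
  then have r: "\<forall>\<^sub>F n in sequentially. (1 + 1 / real n)\<^sup>2 * (lam n / real n) < 1"
    using c by (intro order_tendstoD(2)) auto
  \<comment> \<open>Relative to \<open>n^2\<close> the geometric part of the second moment tends to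
    0, so the maximum becomes \<open>n^2\<close> and the prefactor exactly \<open>n\<close>.\<close>
  have "(\<lambda>n. 2 * (1 / real n)\<^sup>2 / (1 - lam n / real n)\<^sup>2) \<longlonglongrightarrow> 2 * 0\<^sup>2 / (1 - c)\<^sup>2"
    using c by (intro tendsto_intros lim inv) auto
  then have K: "\<forall>\<^sub>F n in sequentially. 2 * (1 / real n)\<^sup>2 / (1 - lam n / real n)\<^sup>2 < 1"
    by (intro order_tendstoD(2)) auto
  have "\<forall>\<^sub>F n in sequentially. mean_queue_bound n (lam n) (L n) (real n)"
    using r K \<gamma>_pos eventually_ge_at_top[of 1]
  proof eventually_elim
    case (elim n)
    then have lam_n: "0 < lam n" "lam n < real n" and n: "0 < real n" using lam by auto
    have "L n = \<gamma> n" using elim by (simp add: L_def)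
    show ?case unfolding \<open>L n = \<gamma> n\<close>
    proof (rule mean_queue_bound_kink[OF lam_n])
      show "1 < 1 + 1 / real n" using n by simp
      show "(1 + 1 / real n)\<^sup>2 * lam n < real n" using elim(1) n by (simp add: field_simps)
      have "(1 + 1 / real n - 1) * (real n / (1 + 1 / real n) - lam n)
          = 1 / (1 + 1 / real n) - lam n / real n"
        using n by (simp add: right_diff_distrib)
      then show "\<gamma> n \<le> (1 + 1 / real n - 1) * (real n / (1 + 1 / real n) - lam n)"
        by (simp add: \<gamma>_def)
      show "\<gamma> n \<le> 1 - lam n * (1 + 1 / real n - 1)" by (simp add: \<gamma>_def)
      have "2 / (1 - lam n / real n)\<^sup>2 = (2 * (1 / real n)\<^sup>2 / (1 - lam n / real n)\<^sup>2) * (real n)\<^sup>2"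
        using n by (simp add: power_divide)
      also have "\<dots> \<le> 1 * (real n)\<^sup>2" using elim(2) by (intro mult_right_mono) auto
      finally show "sqrt (max ((real n)\<^sup>2) (2 / (1 - lam n / real n)\<^sup>2)) \<le> real n"
        by (simp add: max_def)
    qed (use elim in simp)
  qed
  moreover have "\<forall>n\<ge>1. 0 < L n" by (simp add: L_def)
  ultimately show "\<exists>L. (\<forall>n\<ge>1. L n > 0) \<and> L \<longlonglongrightarrow> 1 - c \<and>
      (\<forall>\<^sub>F n in sequentially. mean_queue_bound n (lam n) (L n) (real n))"
    using L_lim by blast
qed

end
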